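(* The category $\mathbf{EA}$ of effect algebras is isomorphic (as a category) to the Eilenberg-Moore category $\mathbf{BPos}^{T}$ for the Kalmbach monad $(T,\eta,\mu)$ on the category $\mathbf{BPos}$ of bounded posets.
   Context: **Bounded posets.** A bounded poset is a structure $(P,\leq,0,1)$ where $\leq$ is a partial order on $P$ and $0,1\in P$ are its bottom and top elements. A morphism of bounded posets is an isotone map $\phi$ with $\phi(0)=0$ and $\phi(1)=1$. The category of bounded posets is $\mathbf{BPos}$. **Effect algebras.** An effect algebra is a partial algebra $(E;\oplus,0,1)$ with a partial binary operation $\oplus$ and two constants $0,1$ such that: (E1) if $a\oplus b$ is defined, then $b\oplus a$ is defined and $a\oplus b=b\oplus a$; (E2) if $a\oplus b$ and $(a\oplus b)\oplus c$ are defined, then $b\oplus c$ and $a\oplus(b\oplus c)$ are defined and $(a\oplus b)\oplus c=a\oplus(b\oplus c)$; (E3) for every $a\in E$ there is a unique $a'\in E$ such that $a\oplus a'$ exists and $a\oplus a'=1$; (E4) if $a\oplus 1$ is defined, then $a=0$. A morphism of effect algebras is a map $\phi:E_1\to E_2$ such that $\phi(1)=1$ and, whenever $a\oplus b$ is defined, $\phi(a)\oplus\phi(b)$ is defined and $\phi(a\oplus b)=\phi(a)\oplus\phi(b)$. The category of effect algebras is $\mathbf{EA}$. **Orthomodular posets.** An orthomodular poset is a structure $(A,\leq,{}',0,1)$ such that $(A,\leq,0,1)$ is a bounded poset and $'$ is a unary operation satisfying: $x\leq y$ implies $y'\leq x'$; $x''=x$; $x\wedge x'=0$; if $x\leq y'$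 then $x\vee y$ exists; if $x\leq y$ then $x\vee(x\vee y')'=y$. A morphism of orthomodular posets is a map $\phi$ such that $\phi(1)=1$ and, if $a\leq b'$, then $\phi(a)\leq\phi(b)'$ and $\phi(a\vee b)=\phi(a)\vee\phi(b)$. The category of orthomodular posets is $\mathbf{OMP}$. **Kalmbach construction.** For a finite chain $C=\{x_1,\dots,x_n\}$ in a poset, write $C=[x_1<\dots<x_n]$ to indicate the order. Let $\Delta$ denote symmetric difference of sets. For a bounded poset $P$ let $K(P)$ be the set of all finite chains in $P$ with an even number of elements (including $\emptyset$), partially ordered by: $[x_1<\dots<x_{2n}]\leq[y_1<\dots<y_{2k}]$ iff for every $1\leq i\leq n$ there is $1\leq j\leq k$ such that $y_{2j-1}\leq x_{2i-1}<x_{2i}\leq y_{2j}$. The bottom is $\emptyset$, the top is $\{0\}\Delta\{1\}$, and the orthocomplementation is $C\mapsto C^\perp=C\,\Delta\,\{0\}\,\Delta\,\{1\}$; with this structure $K(P)$ is an orthomodular poset. For a morphism $f:P\to Q$ in $\mathbf{BPos}$, $$K(f)([x_1<\dots<x_{2n}])=\{f(x_1)\}\,\Delta\,\{f(x_2)\}\,\Delta\cdots\Delta\,\{f(x_{2n})\}.$$ This gives a functor $K:\mathbf{BPos}\to\mathbf{OMP}$, which is (a known fact) left adjoint to the forgetful functor $U:\mathbf{OMP}\to\mathbf{BPos}$, with unit $\eta$ given below and counit $\epsilon_L([x_1<\dots<x_{2n}])=(x_1^\perp\wedge x_2)\vee\dots\vee(x_{2n-1}^\perp\wedge x_{2n})$,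 where ${}^\perp$ denotes the orthocomplementation of $L$. **Kalmbach monad.** The Kalmbach monad is the monad $(T,\eta,\mu)$ on $\mathbf{BPos}$ arising from the adjunction $K\dashv U$. Explicitly: $T=U\circ K$; $\eta_P:P\to T(P)$ is given by $\eta_P(a)=[0<a]$ if $a>0$ and $\eta_P(0)=\emptyset$; and $\mu=U\epsilon K:T^2\to T$ is given by $$\mu_P\bigl([C_1<C_2<\dots<C_{2n}]\bigr)=C_1\,\Delta\,C_2\,\Delta\cdots\Delta\,C_{2n}.$$ **Eilenberg-Moore category.** The objects of $\mathbf{BPos}^T$ are pairs $(A,\alpha)$ with $A$ a bounded poset and $\alpha:T(A)\to A$ a morphism in $\mathbf{BPos}$ such that $\alpha\circ\eta_A=1_A$ and $\alpha\circ T(\alpha)=\alpha\circ\mu_A$. A morphism $h:(A_1,\alpha_1)\to(A_2,\alpha_2)$ is a morphism $h:A_1\to A_2$ in $\mathbf{BPos}$ with $h\circ\alpha_1=\alpha_2\circ T(h)$. *)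

theory Defs
  imports Main "HOL-Library.FuncSet"
begin

section \<open>Categories\<close>

text \<open>
  Hom-sets need not be disjoint, so composition is indexed by the objects involved:
  \<open>Comp C X Y Z g f\<close> is the composite of \<open>f : X \<rightarrow> Y\<close> and \<open>g : Y \<rightarrow> Z\<close>.
\<close>

record ('o, 'm) category =
  Obj :: "'o set"
  Hom :: "'o \<Rightarrow> 'o \<Rightarrow> 'm set"
  Id :: "'o \<Rightarrow> 'm"
  Comp :: "'o \<Rightarrow> 'o \<Rightarrow> 'o \<Rightarrow> 'm \<Rightarrow> 'm \<Rightarrow> 'm"

definition is_category :: "('o, 'm) category \<Rightarrow> bool" where
  "is_category C \<longleftrightarrow>
     (\<forall>X \<in> Obj C. Id C X \<in> Hom C X X) \<and>
     (\<forall>X \<in> Obj C. \<forall>Y \<in> Obj C. \<forall>Z \<in> Obj C. \<forall>f \<in> Hom C X Y. \<forall>g \<in> Hom C Y Z.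
        Comp C X Y Z g f \<in> Hom C X Z) \<and>
     (\<forall>X \<in> Obj C. \<forall>Y \<in> Obj C. \<forall>f \<in> Hom C X Y.
        Comp C X X Y f (Id C X) = f \<and> Comp C X Y Y (Id C Y) f = f) \<and>
     (\<forall>W \<in> Obj C. \<forall>X \<in> Obj C. \<forall>Y \<in> Obj C. \<forall>Z \<in> Obj C.
      \<forall>f \<in> Hom C W X. \<forall>g \<in> Hom C X Y. \<forall>h \<in> Hom C Y Z.
        Comp C W Y Z h (Comp C W X Y g f) = Comp C W X Z (Comp C X Y Z h g) f)"

definition is_functor ::
  "('o, 'm) category \<Rightarrow> ('p, 'n) category \<Rightarrow> ('o \<Rightarrow> 'p) \<Rightarrow> ('o \<Rightarrow> 'o \<Rightarrow> 'm \<Rightarrow> 'n) \<Rightarrow> bool" where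
  "is_functor C D F\<^sub>0 F\<^sub>1 \<longleftrightarrow>
     (\<forall>X \<in> Obj C. F\<^sub>0 X \<in> Obj D) \<and>
     (\<forall>X \<in> Obj C. \<forall>Y \<in> Obj C. \<forall>f \<in> Hom C X Y. F\<^sub>1 X Y f \<in> Hom D (F\<^sub>0 X) (F\<^sub>0 Y)) \<and>
     (\<forall>X \<in> Obj C. F\<^sub>1 X X (Id C X) = Id D (F\<^sub>0 X)) \<and>
     (\<forall>X \<in> Obj C. \<forall>Y \<in> Obj C. \<forall>Z \<in> Obj C. \<forall>f \<in> Hom C X Y. \<forall>g \<in> Hom C Y Z.
        F\<^sub>1 X Z (Comp C X Y Z g f) = Comp D (F\<^sub>0 X) (F\<^sub>0 Y) (F\<^sub>0 Z) (F\<^sub>1 Y Z g) (F\<^sub>1 X Y f))"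

definition isomorphic_categories :: "('o, 'm) category \<Rightarrow> ('p, 'n) category \<Rightarrow> bool" where
  "isomorphic_categories C D \<longleftrightarrow>
     is_category C \<and> is_category D \<and>
     (\<exists>F\<^sub>0 F\<^sub>1 G\<^sub>0 G\<^sub>1.
        is_functor C D F\<^sub>0 F\<^sub>1 \<and> is_functor D C G\<^sub>0 G\<^sub>1 \<and>
        (\<forall>X \<in> Obj C. G\<^sub>0 (F\<^sub>0 X) = X) \<and>
        (\<forall>X \<in> Obj C. \<forall>Y \<in> Obj C. \<forall>f \<in> Hom C X Y. G\<^sub>1 (F\<^sub>0 X) (F\<^sub>0 Y) (F\<^sub>1 X Y f) = f) \<and>
        (\<forall>X \<in> Obj D. F\<^sub>0 (G\<^sub>0 X) = X) \<and>
        (\<forall>X \<in> Obj D. \<forall>Y \<in> Obj D. \<forall>f \<in> Hom D X Y. F\<^sub>1 (G\<^sub>0 X) (G\<^sub>0 Y) (G\<^sub>1 X Y f) = f))"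


section \<open>Effect algebras\<close>

text \<open>
  Structures have a carrier set inside a type \<open>'a\<close>. All data are normalised outside the carrier
  (partial operations are undefined there, order relations contain only pairs of carrier elements,
  maps are extensional), so that HOL equality of structures and of maps is mathematical equality.
\<close>

record 'a effect_algebra =
  ea_carrier :: "'a set"
  ea_plus :: "'a \<Rightarrow> 'a \<Rightarrow> 'a option"
  ea_zero :: 'a
  ea_one :: 'a

definition is_effect_algebra :: "'a effect_algebra \<Rightarrow> bool" where
  "is_effect_algebra E \<longleftrightarrow>
     ea_zero E \<in> ea_carrier E \<and> ea_one E \<in> ea_carrier E \<and>
     (\<forall>a b c. ea_plus E a b = Some c \<longrightarrow>
        a \<in> ea_carrier E \<and> b \<in> ea_carrier E \<and> c \<in> ea_carrier E) \<and>
     (\<forall>a b c. ea_plus E a b = Some c \<longrightarrow> ea_plus E b a = Some c) \<and>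
     (\<forall>a b c d e. ea_plus E a b = Some d \<and> ea_plus E d c = Some e \<longrightarrow>
        (\<exists>f. ea_plus E b c = Some f \<and> ea_plus E a f = Some e)) \<and>
     (\<forall>a \<in> ea_carrier E. \<exists>!a'. a' \<in> ea_carrier E \<and> ea_plus E a a' = Some (ea_one E)) \<and>
     (\<forall>a \<in> ea_carrier E. ea_plus E a (ea_one E) \<noteq> None \<longrightarrow> a = ea_zero E)"

definition ea_hom :: "'a effect_algebra \<Rightarrow> 'b effect_algebra \<Rightarrow> ('a \<Rightarrow> 'b) set" where
  "ea_hom E F = {\<phi> \<in> ea_carrier E \<rightarrow>\<^sub>E ea_carrier F.
     \<phi> (ea_one E) = ea_one F \<and>
     (\<forall>a b c. ea_plus E a b = Some c \<longrightarrow> ea_plus F (\<phi> a) (\<phi> b) = Some (\<phi> c))}"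

definition EA :: "('a effect_algebra, 'a \<Rightarrow> 'a) category" where
  "EA = \<lparr> Obj = {E. is_effect_algebra E},
          Hom = ea_hom,
          Id = (\<lambda>E. \<lambda>x \<in> ea_carrier E. x),
          Comp = (\<lambda>E F G g f. compose (ea_carrier E) g f) \<rparr>"


section \<open>Bounded posets\<close>

record 'a bposet =
  carrier :: "'a set"
  le :: "'a rel"
  bot_el :: 'a
  top_el :: 'a

definition is_bposet :: "'a bposet \<Rightarrow> bool" where
  "is_bposet P \<longleftrightarrow>
     partial_order_on (carrier P) (le P) \<and>
     bot_el P \<in> carrier P \<and> (\<forall>x \<in> carrier P. (bot_el P, x) \<in> le P) \<and>
     top_el P \<in> carrier P \<and> (\<forall>x \<in> carrier P. (x, top_el P) \<in> le P)"

definition bpos_hom :: "'a bposet \<Rightarrow> 'b bposet \<Rightarrow> ('a \<Rightarrow> 'b) set" where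
  "bpos_hom P Q = {\<phi> \<in> carrier P \<rightarrow>\<^sub>E carrier Q.
     (\<forall>x y. (x, y) \<in> le P \<longrightarrow> (\<phi> x, \<phi> y) \<in> le Q) \<and>
     \<phi> (bot_el P) = bot_el Q \<and> \<phi> (top_el P) = top_el Q}"

definition bpos_id :: "'a bposet \<Rightarrow> 'a \<Rightarrow> 'a" where
  "bpos_id P = (\<lambda>x \<in> carrier P. x)"

definition bpos_comp :: "'a bposet \<Rightarrow> ('b \<Rightarrow> 'c) \<Rightarrow> ('a \<Rightarrow> 'b) \<Rightarrow> 'a \<Rightarrow> 'c" where
  "bpos_comp P g f = compose (carrier P) g f"


section \<open>The Kalmbach monad\<close>

text \<open>\<open>Sym_Diff f {x\<^sub>1, \<dots>, x\<^sub>n} = f x\<^sub>1 \<Delta> \<dots> \<Delta> f x\<^sub>n\<close>, with the empty symmetric difference being empty.\<close>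

definition Sym_Diff :: "('a \<Rightarrow> 'b set) \<Rightarrow> 'a set \<Rightarrow> 'b set" where
  "Sym_Diff f C = Finite_Set.fold (\<lambda>x S. sym_diff (f x) S) {} C"

lemma Sym_Diff_empty [simp]: "Sym_Diff f {} = {}"
  by (simp add: Sym_Diff_def)

lemma Sym_Diff_insert:
  assumes "finite C" "x \<notin> C"
  shows "Sym_Diff f (insert x C) = sym_diff (f x) (Sym_Diff f C)"
proof -
  interpret comp_fun_commute "\<lambda>x S. sym_diff (f x) S"
    by standard (auto simp: fun_eq_iff)
  show ?thesis
    using assms by (simp add: Sym_Diff_def)
qed

text \<open>\<open>chain_enum P C [x\<^sub>1, \<dots>, x\<^sub>n]\<close> renders \<open>C = [x\<^sub>1 < \<dots> < x\<^sub>n]\<close> in \<open>P\<close>.\<close>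

definition chain_enum :: "'a bposet \<Rightarrow> 'a set \<Rightarrow> 'a list \<Rightarrow> bool" where
  "chain_enum P C xs \<longleftrightarrow> set xs = C \<and> sorted_wrt (\<lambda>x y. (x, y) \<in> le P \<and> x \<noteq> y) xs"

definition even_chains :: "'a bposet \<Rightarrow> 'a set set" where
  "even_chains P = {C \<in> Chains (le P). C \<subseteq> carrier P \<and> finite C \<and> even (card C)}"

text \<open>
  List positions start at 0, so the pairs \<open>x\<^sub>2\<^sub>i\<^sub>-\<^sub>1 < x\<^sub>2\<^sub>i\<close> of the usual 1-based enumeration are
  \<open>xs ! (2 * i) < xs ! (2 * i + 1)\<close>.
\<close>

definition kalmbach_le :: "'a bposet \<Rightarrow> 'a set rel" where
  "kalmbach_le P = {(C, D). C \<in> even_chains P \<and> D \<in> even_chains P \<and>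
     (\<exists>xs ys. chain_enum P C xs \<and> chain_enum P D ys \<and>
        (\<forall>i < length xs div 2. \<exists>j < length ys div 2.
           (ys ! (2 * j), xs ! (2 * i)) \<in> le P \<and>
           (xs ! (2 * i + 1), ys ! (2 * j + 1)) \<in> le P))}"

definition T :: "'a bposet \<Rightarrow> 'a set bposet" where
  "T P = \<lparr> carrier = even_chains P,
           le = kalmbach_le P,
           bot_el = {},
           top_el = sym_diff {bot_el P} {top_el P} \<rparr>"

definition T_map :: "'a bposet \<Rightarrow> ('a \<Rightarrow> 'b) \<Rightarrow> 'a set \<Rightarrow> 'b set" where
  "T_map P f = (\<lambda>C \<in> carrier (T P). Sym_Diff (\<lambda>x. {f x}) C)"

definition \<eta> :: "'a bposet \<Rightarrow> 'a \<Rightarrow> 'a set" where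
  "\<eta> P = (\<lambda>a \<in> carrier P. if a = bot_el P then {} else {bot_el P, a})"

definition \<mu> :: "'a bposet \<Rightarrow> 'a set set \<Rightarrow> 'a set" where
  "\<mu> P = (\<lambda>X \<in> carrier (T (T P)). Sym_Diff (\<lambda>C. C) X)"


section \<open>The Eilenberg-Moore category\<close>

text \<open>
  \<open>T\<close> raises the type of elements from \<open>'a\<close> to \<open>'a set\<close>; the two algebra laws are equations between
  maps \<open>A \<rightarrow> A\<close> and \<open>T (T A) \<rightarrow> A\<close>, with \<open>T_map (T A) \<alpha> : T (T A) \<rightarrow> T A\<close>.
\<close>

definition is_T_algebra :: "'a bposet \<times> ('a set \<Rightarrow> 'a) \<Rightarrow> bool" where
  "is_T_algebra = (\<lambda>(A, \<alpha>).
     is_bposet A \<and> \<alpha> \<in> bpos_hom (T A) A \<and>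
     bpos_comp A \<alpha> (\<eta> A) = bpos_id A \<and>
     bpos_comp (T (T A)) \<alpha> (T_map (T A) \<alpha>) = bpos_comp (T (T A)) \<alpha> (\<mu> A))"

definition T_algebra_hom ::
  "'a bposet \<times> ('a set \<Rightarrow> 'a) \<Rightarrow> 'b bposet \<times> ('b set \<Rightarrow> 'b) \<Rightarrow> ('a \<Rightarrow> 'b) set" where
  "T_algebra_hom = (\<lambda>(A, \<alpha>) (B, \<beta>).
     {h \<in> bpos_hom A B. bpos_comp (T A) h \<alpha> = bpos_comp (T A) \<beta> (T_map A h)})"

definition BPos_T :: "('a bposet \<times> ('a set \<Rightarrow> 'a), 'a \<Rightarrow> 'a) category" where
  "BPos_T = \<lparr> Obj = {X. is_T_algebra X},
              Hom = T_algebra_hom,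
              Id = (\<lambda>X. bpos_id (fst X)),
              Comp = (\<lambda>X Y Z g f. bpos_comp (fst X) g f) \<rparr>"

end

theory Submission
  imports Defs
begin

text \<open>
  The bridge between the two sides is subtraction. In an effect algebra, ordered by \<open>a \<le> b\<close> iff
  \<open>a \<oplus> c = b\<close> for some \<open>c\<close>, this \<open>c\<close> is unique and written \<open>b \<ominus> a\<close>. In a \<open>T\<close>-algebra \<open>(A, \<alpha>)\<close>, put
  \<open>b \<ominus> a = \<alpha> [a < b]\<close> for \<open>a < b\<close>, and \<open>a \<ominus> a = \<alpha> {} = 0\<close>. Both kinds of structure are determined by
  their order together with this partial subtraction, and the same subtractions arise on both sides,
  namely those of difference posets. A \<open>T\<close>-algebra must have
    \<open>\<alpha> [x\<^sub>1 < \<dots> < x\<^sub>2\<^sub>n] = x\<^sub>2\<^sub>n \<ominus> (x\<^sub>2\<^sub>n\<^sub>-\<^sub>1 \<ominus> (\<dots> \<ominus> (x\<^sub>2 \<ominus> x\<^sub>1)))\<close>,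
  which is the orthosum of the lengths \<open>x\<^sub>2\<^sub>i \<ominus> x\<^sub>2\<^sub>i\<^sub>-\<^sub>1\<close> of the blocks of the chain. Two reasons make the
  alternating difference preferable to the orthosum. It is built by adjoining one maximum at a time,
  and by \<open>x \<ominus> (x \<ominus> r) = r\<close> it does not see a point that occurs twice, so that it turns symmetric
  differences of singletons, hence \<open>T\<close> on maps, into plain recursion (\<open>alt_Sym_Diff_insert\<close>).

  The order of \<open>K(P)\<close> is handled through one predicate: a point lies \<open>inside\<close> a chain if the chain has
  an odd number of elements below it. Symmetric difference of chains is exclusive disjunction of
  these predicates, and \<open>C \<le> D\<close> in \<open>K(P)\<close> means that \<open>C \<union> D\<close> is a chain and every point inside \<open>C\<close> is
  inside \<open>D\<close> (\<open>kalmbach_le_imp\<close>, \<open>kalmbach_leI\<close>).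

  From an effect algebra to a \<open>T\<close>-algebra, everything follows from one identity (\<open>alt_additive\<close>): if
  \<open>D \<le> C\<close> then \<open>\<alpha> (C \<Delta> D) \<oplus> \<alpha> D = \<alpha> C\<close>. It says that the measure of the region inside a chain is
  additive. It gives monotonicity of \<open>\<alpha>\<close> at once, and, applied to the largest member \<open>C\<^sub>n\<close> of a chain
  \<open>C\<^sub>1 < \<dots> < C\<^sub>n\<close> of \<open>K(P)\<close> and to \<open>D = C\<^sub>1 \<Delta> \<dots> \<Delta> C\<^sub>n\<^sub>-\<^sub>1 \<le> C\<^sub>n\<close>, it gives
  \<open>\<alpha> \<circ> T(\<alpha>) = \<alpha> \<circ> \<mu>\<close> by induction on \<open>n\<close> (\<open>alt_Sym_Diff_alt\<close>).

  In the other direction the associativity law of \<open>(A, \<alpha>)\<close> at a chain \<open>[D < C]\<close> of \<open>K(A)\<close> reads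
  \<open>\<alpha> C \<ominus> \<alpha> D = \<alpha> (D \<Delta> C)\<close> (\<open>algebra_diff_alpha\<close>). Taking chains with two elements for \<open>D\<close> and \<open>C\<close> yields the
  axioms of a difference poset, and every difference poset is an effect algebra
  (\<open>is_effect_algebra_diff_ea\<close>). Taking \<open>[0 < m]\<close> for \<open>C\<close> yields the recursion for the alternating
  difference, so that \<open>\<alpha>\<close> is recovered from its subtraction (\<open>ea_alt_algebra_ea\<close>). A map is a morphism
  on one side iff it is one on the other (\<open>T_algebra_hom_kalmbach_algebra\<close>), so the isomorphism of
  categories is the identity on arrows.
\<close>

section \<open>Symmetric differences\<close>

lemma even_card_sym_diff:
  assumes "finite A" "finite B"
  shows "even (card (sym_diff A B)) \<longleftrightarrow> (even (card A) \<longleftrightarrow> even (card B))"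
proof -
  have "card (sym_diff A B) = card (A - B) + card (B - A)"
    using assms by (intro card_Un_disjoint) auto
  moreover have "card A = card (A - B) + card (A \<inter> B)"
    using assms by (subst card_Un_disjoint [symmetric]) (auto intro: arg_cong [of _ _ card])
  moreover have "card B = card (B - A) + card (A \<inter> B)"
    using assms by (subst card_Un_disjoint [symmetric]) (auto intro: arg_cong [of _ _ card])
  ultimately show ?thesis by auto
qed

lemma Sym_Diff_subset: "finite X \<Longrightarrow> Sym_Diff f X \<subseteq> (\<Union>x\<in>X. f x)"
  by (induction rule: finite_induct) (auto simp: Sym_Diff_insert)

lemma Sym_Diff_singletons_subset: "finite X \<Longrightarrow> Sym_Diff (\<lambda>x. {f x}) X \<subseteq> f ` X"
  by (rule order_trans [OF Sym_Diff_subset]) auto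

lemma finite_Sym_Diff: "finite X \<Longrightarrow> (\<And>x. x \<in> X \<Longrightarrow> finite (f x)) \<Longrightarrow> finite (Sym_Diff f X)"
  by (rule finite_subset [OF Sym_Diff_subset]) auto

lemma Sym_Diff_singleton: "Sym_Diff f {x} = f x"
  by (simp add: Sym_Diff_insert)

lemma Sym_Diff_pair: "Sym_Diff f (sym_diff {x} {y}) = sym_diff (f x) (f y)"
proof (cases "x = y")
  case False
  then have "sym_diff {x} {y} = insert x {y}" by auto
  moreover have "Sym_Diff f (insert x {y}) = sym_diff (f x) (Sym_Diff f {y})"
    using False by (intro Sym_Diff_insert) auto
  ultimately show ?thesis by (simp only: Sym_Diff_singleton)
qed simp

lemma even_card_Sym_Diff:
  assumes "finite X" "\<And>x. x \<in> X \<Longrightarrow> finite (f x) \<and> even (card (f x))"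
  shows "even (card (Sym_Diff f X))"
  using assms
proof (induction rule: finite_induct)
  case (insert x X)
  then show ?case
    by (simp add: Sym_Diff_insert even_card_sym_diff finite_Sym_Diff)
qed simp

lemma even_card_Sym_Diff_singletons:
  assumes "finite X"
  shows "even (card (Sym_Diff (\<lambda>x. {f x}) X)) \<longleftrightarrow> even (card X)"
  using assms
proof (induction rule: finite_induct)
  case (insert x X)
  have "even (card (Sym_Diff (\<lambda>x. {f x}) (insert x X)))
      \<longleftrightarrow> (even (card {f x}) \<longleftrightarrow> even (card (Sym_Diff (\<lambda>x. {f x}) X)))"
    unfolding Sym_Diff_insert [OF insert.hyps]
    by (rule even_card_sym_diff) (simp_all add: finite_Sym_Diff insert.hyps)
  with insert show ?case by simp
qed simp

lemma Sym_Diff_cong: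
  assumes "finite X" "\<And>x. x \<in> X \<Longrightarrow> f x = g x"
  shows "Sym_Diff f X = Sym_Diff g X"
  using assms by (induction rule: finite_induct) (simp_all add: Sym_Diff_insert)

lemma even_card_pair: "even (card (sym_diff {x} {y}))"
  by (simp only: even_card_sym_diff finite.intros) simp


section \<open>Finite chains and their blocks\<close>

definition finite_chains :: "'a bposet \<Rightarrow> 'a set set" where
  "finite_chains P = {C \<in> Chains (le P). C \<subseteq> carrier P \<and> finite C}"

text \<open>
  The points inside \<open>[x\<^sub>1 < \<dots> < x\<^sub>2\<^sub>n]\<close> form the union of the half-open blocks, a block consisting of
  the points that are above \<open>x\<^sub>2\<^sub>i\<^sub>-\<^sub>1\<close> and not above \<open>x\<^sub>2\<^sub>i\<close>. Counting elements below a point instead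
  of referring to an enumeration makes symmetric differences easy, and lets the notion apply to
  points that are not comparable with all of the chain and to chains with an odd number of elements.
\<close>

definition inside :: "'a bposet \<Rightarrow> 'a set \<Rightarrow> 'a \<Rightarrow> bool" where
  "inside P C z \<longleftrightarrow> odd (card {x \<in> C. (x, z) \<in> le P})"

definition block :: "'a bposet \<Rightarrow> 'a set \<Rightarrow> 'a \<Rightarrow> 'a \<Rightarrow> bool" where
  "block P C a b \<longleftrightarrow> a \<in> C \<and> b \<in> C \<and> (a, b) \<in> le P \<and> a \<noteq> b \<and> inside P C a \<and>
     (\<forall>c \<in> C. (c, a) \<in> le P \<or> (b, c) \<in> le P)"

lemma even_chains_eq: "even_chains P = {C \<in> finite_chains P. even (card C)}"
  by (auto simp: even_chains_def finite_chains_def)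

lemma even_chains_finite: "C \<in> even_chains P \<Longrightarrow> C \<in> finite_chains P"
  by (simp add: even_chains_eq)

lemma finite_chains_subset: "C \<in> finite_chains P \<Longrightarrow> D \<subseteq> C \<Longrightarrow> D \<in> finite_chains P"
  by (auto simp: finite_chains_def Chains_def intro: finite_subset)

lemma finite_chains_finite: "C \<in> finite_chains P \<Longrightarrow> finite C"
  by (simp add: finite_chains_def)

lemma finite_chains_carrier: "C \<in> finite_chains P \<Longrightarrow> x \<in> C \<Longrightarrow> x \<in> carrier P"
  by (auto simp: finite_chains_def)

lemma finite_chains_total:
  "C \<in> finite_chains P \<Longrightarrow> x \<in> C \<Longrightarrow> y \<in> C \<Longrightarrow> (x, y) \<in> le P \<or> (y, x) \<in> le P"
  by (auto simp: finite_chains_def Chains_def)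

lemma finite_chains_empty: "{} \<in> finite_chains P"
  by (auto simp: finite_chains_def Chains_def)

lemma finite_chains_image:
  assumes C: "C \<in> finite_chains P"
    and f: "\<And>x. x \<in> C \<Longrightarrow> f x \<in> carrier Q"
    and mono: "\<And>x y. x \<in> C \<Longrightarrow> y \<in> C \<Longrightarrow> (x, y) \<in> le P \<Longrightarrow> (f x, f y) \<in> le Q"
  shows "f ` C \<in> finite_chains Q"
  using C f mono unfolding finite_chains_def Chains_def by blast

text \<open>
  Coinciding values of \<open>f\<close> are dropped from the symmetric difference, but cancellation removes points
  in pairs, so the parity of the chain survives.
\<close>

lemma Sym_Diff_image_even_chain:
  assumes C: "C \<in> even_chains P" and im: "f ` C \<in> finite_chains Q"
  shows "Sym_Diff (\<lambda>x. {f x}) C \<in> even_chains Q"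
proof -
  have fin: "finite C" using C by (simp add: even_chains_def)
  have "Sym_Diff (\<lambda>x. {f x}) C \<subseteq> f ` C" using fin by (rule Sym_Diff_singletons_subset)
  then have "Sym_Diff (\<lambda>x. {f x}) C \<in> finite_chains Q" using im finite_chains_subset by blast
  then show ?thesis
    using C even_card_Sym_Diff_singletons [OF fin] by (simp add: even_chains_eq)
qed

lemma inside_sym_diff:
  assumes "finite C" "finite D"
  shows "inside P (sym_diff C D) z \<longleftrightarrow> (inside P C z \<longleftrightarrow> \<not> inside P D z)"
proof -
  have "{x \<in> sym_diff C D. (x, z) \<in> le P}
      = sym_diff {x \<in> C. (x, z) \<in> le P} {x \<in> D. (x, z) \<in> le P}"
    by auto
  moreover have "finite {x \<in> C. (x, z) \<in> le P}" "finite {x \<in> D. (x, z) \<in> le P}"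
    using assms by auto
  ultimately show ?thesis
    unfolding inside_def by (simp only: even_card_sym_diff) blast
qed

lemma inside_singleton: "inside P {x} z \<longleftrightarrow> (x, z) \<in> le P"
proof (cases "(x, z) \<in> le P")
  case True
  then have "{y \<in> {x}. (y, z) \<in> le P} = {x}" by auto
  then have "inside P {x} z" unfolding inside_def by simp
  with True show ?thesis by blast
next
  case False
  then have "{y \<in> {x}. (y, z) \<in> le P} = {}" by auto
  then have "\<not> inside P {x} z" unfolding inside_def by (simp only: card.empty) simp
  with False show ?thesis by blast
qed

lemma inside_pair: "inside P (sym_diff {x} {y}) z \<longleftrightarrow> ((x, z) \<in> le P \<longleftrightarrow> (y, z) \<notin> le P)"
  by (simp only: inside_sym_diff finite.intros inside_singleton)

lemma inside_upper_bound:
  assumes "\<And>c. c \<in> C \<Longrightarrow> (c, m) \<in> le P"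
  shows "inside P C m \<longleftrightarrow> odd (card C)"
proof -
  have "{x \<in> C. (x, m) \<in> le P} = C" using assms by auto
  then show ?thesis by (simp add: inside_def)
qed

text \<open>
  A point is inside a symmetric difference iff it is inside an odd number of the sets; all that
  comparisons in \<open>K(P)\<close> need is that this number is not \<open>0\<close>.
\<close>

lemma inside_Sym_Diff:
  assumes "finite X" "\<And>x. x \<in> X \<Longrightarrow> finite (f x)" "inside P (Sym_Diff f X) z"
  shows "\<exists>x \<in> X. inside P (f x) z"
  using assms
proof (induction rule: finite_induct)
  case empty
  then show ?case by (simp add: inside_def)
next
  case (insert x X)
  then have "inside P (f x) z \<or> inside P (Sym_Diff f X) z"
    using inside_sym_diff [of "f x" "Sym_Diff f X" P z] finite_Sym_Diff [of X f]
    by (auto simp: Sym_Diff_insert)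
  with insert show ?case by auto
qed

lemma T_sel [simp]:
  "carrier (T P) = even_chains P" "le (T P) = kalmbach_le P"
  "bot_el (T P) = {}" "top_el (T P) = sym_diff {bot_el P} {top_el P}"
  by (simp_all add: T_def)

locale bounded_poset =
  fixes P :: "'a bposet"
  assumes bposet: "is_bposet P"
begin

lemma le_carrier: "(x, y) \<in> le P \<Longrightarrow> x \<in> carrier P" "(x, y) \<in> le P \<Longrightarrow> y \<in> carrier P"
  using bposet partial_order_onD(4) by (fastforce simp: is_bposet_def)+

lemma le_refl: "x \<in> carrier P \<Longrightarrow> (x, x) \<in> le P"
  using bposet partial_order_onD(1) by (fastforce simp: is_bposet_def refl_on_def)

lemma le_trans: "(x, y) \<in> le P \<Longrightarrow> (y, z) \<in> le P \<Longrightarrow> (x, z) \<in> le P"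
  using bposet partial_order_onD(2) by (fastforce simp: is_bposet_def dest: transD)

lemma le_antisym: "(x, y) \<in> le P \<Longrightarrow> (y, x) \<in> le P \<Longrightarrow> x = y"
  using bposet partial_order_onD(3) by (fastforce simp: is_bposet_def dest: antisymD)

lemma bot_carrier: "bot_el P \<in> carrier P" and top_carrier: "top_el P \<in> carrier P"
  and bot_le: "x \<in> carrier P \<Longrightarrow> (bot_el P, x) \<in> le P"
  and le_top: "x \<in> carrier P \<Longrightarrow> (x, top_el P) \<in> le P"
  using bposet by (auto simp: is_bposet_def)

lemma finite_chains_insert:
  assumes "C \<in> finite_chains P" "m \<in> carrier P" "\<And>c. c \<in> C \<Longrightarrow> (c, m) \<in> le P"
  shows "insert m C \<in> finite_chains P"
  using assms le_refl by (auto simp: finite_chains_def Chains_def)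

lemma pair_finite_chain:
  assumes "(x, y) \<in> le P"
  shows "sym_diff {x} {y} \<in> finite_chains P"
proof (rule finite_chains_subset)
  show "{x, y} \<in> finite_chains P"
    using assms le_carrier le_refl by (auto simp: finite_chains_def Chains_def)
qed auto

lemma pair_even_chain: "(x, y) \<in> le P \<Longrightarrow> sym_diff {x} {y} \<in> even_chains P"
  unfolding even_chains_eq by (intro CollectI conjI pair_finite_chain even_card_pair)

lemma finite_chain_has_max:
  assumes "C \<in> finite_chains P" "C \<noteq> {}"
  shows "\<exists>m \<in> C. \<forall>c \<in> C. (c, m) \<in> le P"
proof -
  have "finite C" using assms finite_chains_finite by blast
  then show ?thesis using assms(2,1)
  proof (induction rule: finite_ne_induct)
    case (singleton x)
    then show ?case by (auto simp: finite_chains_def le_refl)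
  next
    case (insert x F)
    then have "F \<in> finite_chains P" by (auto intro: finite_chains_subset)
    with insert obtain m where m: "m \<in> F" "\<forall>c\<in>F. (c, m) \<in> le P" by blast
    have "(x, m) \<in> le P \<or> (m, x) \<in> le P"
      using finite_chains_total [OF insert.prems, of x m] m by auto
    then show ?case
    proof
      assume "(x, m) \<in> le P"
      with m show ?thesis by blast
    next
      assume mx: "(m, x) \<in> le P"
      have "\<forall>c \<in> insert x F. (c, x) \<in> le P"
        using m(2) mx le_trans le_refl [OF le_carrier(2) [OF mx]] by blast
      then show ?thesis by blast
    qed
  qed
qed

text \<open>
  Chains grow from below: the element adjoined is always the new maximum, which is the order in which
  alternating differences are evaluated.
\<close>

lemma finite_chain_induct [consumes 1, case_names empty insert]:
  assumes "C \<in> finite_chains P"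
    and empty: "Q {}"
    and ins: "\<And>m C. C \<in> finite_chains P \<Longrightarrow> m \<in> carrier P \<Longrightarrow> m \<notin> C \<Longrightarrow>
      (\<And>c. c \<in> C \<Longrightarrow> (c, m) \<in> le P) \<Longrightarrow> Q C \<Longrightarrow> Q (insert m C)"
  shows "Q C"
proof -
  have "finite C" using assms finite_chains_finite by blast
  then show ?thesis using assms(1)
  proof (induction rule: finite_psubset_induct)
    case (psubset C)
    show ?case
    proof (cases "C = {}")
      case True
      with empty show ?thesis by simp
    next
      case False
      with psubset finite_chain_has_max obtain m
        where m: "m \<in> C" "\<forall>c \<in> C. (c, m) \<in> le P" by blast
      have D: "C - {m} \<in> finite_chains P"
        using psubset.prems by (auto intro: finite_chains_subset)
      then have "Q (C - {m})" using psubset m by blast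
      then have "Q (insert m (C - {m}))"
        using m psubset.prems D by (intro ins) (auto dest: finite_chains_carrier)
      then show ?thesis using m by (simp add: insert_absorb)
    qed
  qed
qed

lemma chain_enum_exists:
  assumes "C \<in> finite_chains P"
  shows "\<exists>xs. chain_enum P C xs"
  using assms
proof (induction rule: finite_chain_induct)
  case empty
  then show ?case by (simp add: chain_enum_def)
next
  case (insert m C)
  then obtain xs where "chain_enum P C xs" by blast
  then have "chain_enum P (insert m C) (xs @ [m])"
    using insert by (auto simp: chain_enum_def sorted_wrt_append)
  then show ?case by blast
qed

lemma chain_enum_unique:
  assumes "chain_enum P C xs" "chain_enum P C ys"
  shows "xs = ys"
  using assms
proof (induction xs arbitrary: C ys rule: rev_induct)
  case Nil
  then show ?case by (auto simp: chain_enum_def)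
next
  case (snoc x xs)
  then obtain y zs where ys: "ys = zs @ [y]"
    by (cases ys rule: rev_cases) (auto simp: chain_enum_def)
  have "x = y"
  proof (rule ccontr)
    assume "x \<noteq> y"
    then have "x \<in> set zs" "y \<in> set xs" using snoc.prems ys by (auto simp: chain_enum_def)
    then show False using snoc.prems ys le_antisym
      by (auto simp: chain_enum_def sorted_wrt_append)
  qed
  have "x \<notin> set xs" "y \<notin> set zs"
    using snoc.prems ys by (auto simp: chain_enum_def sorted_wrt_append)
  then have "chain_enum P (C - {x}) xs" "chain_enum P (C - {x}) zs"
    using snoc.prems ys \<open>x = y\<close> by (auto simp: chain_enum_def sorted_wrt_append)
  with snoc.IH ys \<open>x = y\<close> show ?case by blast
qed

lemma chain_enum_distinct: "chain_enum P C xs \<Longrightarrow> distinct xs"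
  by (auto simp: chain_enum_def distinct_conv_nth sorted_wrt_iff_nth_less)
    (metis linorder_neqE_nat)

lemma chain_enum_length: "chain_enum P C xs \<Longrightarrow> length xs = card C"
  using chain_enum_distinct distinct_card by (force simp: chain_enum_def)

lemma chain_enum_nth_le_iff:
  assumes "C \<in> finite_chains P" "chain_enum P C xs" "i < length xs" "j < length xs"
  shows "(xs ! i, xs ! j) \<in> le P \<longleftrightarrow> i \<le> j"
proof -
  have 1: "(xs ! k, xs ! l) \<in> le P \<and> xs ! k \<noteq> xs ! l" if "k < l" "l < length xs" for k l
    using assms that by (auto simp: chain_enum_def sorted_wrt_iff_nth_less)
  have "xs ! i \<in> carrier P"
    using assms finite_chains_carrier by (fastforce simp: chain_enum_def)
  then have "(xs ! i, xs ! i) \<in> le P" by (rule le_refl)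
  then show ?thesis using 1 [of i j] 1 [of j i] assms(3,4) le_antisym [of "xs ! i" "xs ! j"]
    by (cases i j rule: linorder_cases) auto
qed

text \<open>
  The elements of a chain below an arbitrary point form an initial segment of its enumeration. This is
  what links counting, as in \<open>inside\<close>, with positions, as in the order of \<open>K(P)\<close>.
\<close>

lemma chain_enum_nth_below_iff:
  assumes "chain_enum P C xs" "i < length xs"
  shows "(xs ! i, z) \<in> le P \<longleftrightarrow> i < card {x \<in> C. (x, z) \<in> le P}"
  using assms
proof (induction xs arbitrary: C i rule: rev_induct)
  case Nil
  then show ?case by simp
next
  case (snoc m xs)
  have nin: "m \<notin> set xs" and C: "C = insert m (set xs)"
    using snoc.prems by (auto simp: chain_enum_def sorted_wrt_append)
  have enum: "chain_enum P (set xs) xs"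
    using snoc.prems by (auto simp: chain_enum_def sorted_wrt_append)
  show ?case
  proof (cases "(m, z) \<in> le P")
    case True
    have below: "(x, z) \<in> le P" if "x \<in> C" for x
      using that snoc.prems True le_trans C
      by (auto simp: chain_enum_def sorted_wrt_append)
    then have "{x \<in> C. (x, z) \<in> le P} = C" by auto
    moreover have "(xs @ [m]) ! i \<in> C"
      using snoc.prems nth_mem [of i "xs @ [m]"] by (auto simp: chain_enum_def)
    ultimately show ?thesis
      using below chain_enum_length [OF snoc.prems(1)] snoc.prems(2) by auto
  next
    case False
    then have eq: "{x \<in> C. (x, z) \<in> le P} = {x \<in> set xs. (x, z) \<in> le P}"
      using C by auto
    show ?thesis
    proof (cases "i < length xs")
      case True
      then show ?thesis using snoc.IH [OF enum True] eq by (simp add: nth_append)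
    next
      case i: False
      have "card {x \<in> set xs. (x, z) \<in> le P} \<le> card (set xs)"
        by (rule card_mono) auto
      also have "\<dots> \<le> length xs" by (rule card_length)
      finally show ?thesis using i False snoc.prems(2) eq by (auto simp: nth_append)
    qed
  qed
qed

lemma chain_enum_inside_nth:
  assumes "C \<in> finite_chains P" "chain_enum P C xs" "i < length xs"
  shows "inside P C (xs ! i) \<longleftrightarrow> even i"
proof -
  let ?k = "card {x \<in> C. (x, xs ! i) \<in> le P}"
  have len: "?k \<le> length xs"
    unfolding chain_enum_length [OF assms(2)]
    using assms finite_chains_finite by (intro card_mono) auto
  have *: "j < ?k \<longleftrightarrow> j \<le> i" if "j < length xs" for j
    using chain_enum_nth_below_iff [OF assms(2) that] chain_enum_nth_le_iff [OF assms(1,2) that assms(3)]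
    by blast
  have "?k = Suc i"
    using * [of i] * [of "Suc i"] len assms(3) by (cases "Suc i < length xs") auto
  then show ?thesis by (simp add: inside_def)
qed

lemma block_iff_nth:
  assumes "C \<in> finite_chains P" "even (card C)" "chain_enum P C xs"
  shows "block P C a b \<longleftrightarrow> (\<exists>i < length xs div 2. a = xs ! (2 * i) \<and> b = xs ! (2 * i + 1))"
proof
  assume bl: "block P C a b"
  then obtain k l where k: "k < length xs" "a = xs ! k" and l: "l < length xs" "b = xs ! l"
    using assms(3) by (metis block_def chain_enum_def in_set_conv_nth)
  have "even k"
    using bl chain_enum_inside_nth [OF assms(1,3) k(1)] k by (simp add: block_def)
  have "k < l"
    using bl chain_enum_nth_le_iff [OF assms(1,3) k(1) l(1)] k l
    by (auto simp: block_def order_less_le)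
  then have "Suc k < length xs" using l by simp
  then have "xs ! Suc k \<in> C" using assms(3) by (auto simp: chain_enum_def)
  then have "(xs ! Suc k, a) \<in> le P \<or> (b, xs ! Suc k) \<in> le P" using bl by (simp add: block_def)
  then have "l \<le> Suc k"
    using k l \<open>Suc k < length xs\<close> chain_enum_nth_le_iff [OF assms(1,3)] by auto
  with \<open>k < l\<close> have "l = Suc k" by simp
  have "2 * (k div 2) = k" using \<open>even k\<close> by simp
  moreover have "k div 2 < length xs div 2"
    using \<open>Suc k < length xs\<close> \<open>even k\<close> by linarith
  ultimately show "\<exists>i < length xs div 2. a = xs ! (2 * i) \<and> b = xs ! (2 * i + 1)"
    using k(2) l(2) \<open>l = Suc k\<close> by (intro exI [of _ "k div 2"]) simp
next
  assume "\<exists>i < length xs div 2. a = xs ! (2 * i) \<and> b = xs ! (2 * i + 1)"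
  then obtain i where i: "i < length xs div 2" "a = xs ! (2 * i)" "b = xs ! (2 * i + 1)" by blast
  then have len: "2 * i < length xs" "2 * i + 1 < length xs" by auto
  have ab: "a \<in> C" "b \<in> C"
    using nth_mem [OF len(1)] nth_mem [OF len(2)] i(2,3) assms(3) by (simp_all add: chain_enum_def)
  have "sorted_wrt (\<lambda>x y. (x, y) \<in> le P \<and> x \<noteq> y) xs" using assms(3) by (simp add: chain_enum_def)
  from sorted_wrt_nth_less [OF this _ len(2), of "2 * i"]
  have "(a, b) \<in> le P" "a \<noteq> b" unfolding i(2,3) by simp_all
  moreover have "inside P C a"
    unfolding i(2) chain_enum_inside_nth [OF assms(1,3) len(1)] by simp
  moreover have "(c, a) \<in> le P \<or> (b, c) \<in> le P" if c: "c \<in> C" for c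
  proof -
    obtain j where j: "j < length xs" "c = xs ! j"
      using c assms(3) by (metis chain_enum_def in_set_conv_nth)
    show ?thesis
      unfolding i(2,3) j(2) chain_enum_nth_le_iff [OF assms(1,3) j(1) len(1)]
        chain_enum_nth_le_iff [OF assms(1,3) len(2) j(1)] by linarith
  qed
  ultimately show "block P C a b" using ab by (simp add: block_def)
qed

text \<open>
  Blocks free the order of \<open>K(P)\<close> from enumerations and make its transitivity evident.
\<close>

lemma kalmbach_le_iff_blocks:
  "(C, D) \<in> kalmbach_le P \<longleftrightarrow> C \<in> even_chains P \<and> D \<in> even_chains P \<and>
     (\<forall>a b. block P C a b \<longrightarrow> (\<exists>c d. block P D c d \<and> (c, a) \<in> le P \<and> (b, d) \<in> le P))"
proof (cases "C \<in> even_chains P \<and> D \<in> even_chains P")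
  case True
  then have C: "C \<in> finite_chains P" "even (card C)" and D: "D \<in> finite_chains P" "even (card D)"
    by (auto simp: even_chains_eq)
  obtain xs ys where xs: "chain_enum P C xs" and ys: "chain_enum P D ys"
    using chain_enum_exists C D by blast
  have "(C, D) \<in> kalmbach_le P \<longleftrightarrow> (\<forall>i < length xs div 2. \<exists>j < length ys div 2.
           (ys ! (2 * j), xs ! (2 * i)) \<in> le P \<and> (xs ! (2 * i + 1), ys ! (2 * j + 1)) \<in> le P)"
    unfolding kalmbach_le_def using True xs ys chain_enum_unique by blast
  then show ?thesis
    using True block_iff_nth [OF C xs] block_iff_nth [OF D ys] by metis
qed (auto simp: kalmbach_le_def)

lemma even_chain_covered_by_blocks:
  assumes "C \<in> even_chains P" "x \<in> C"
  shows "\<exists>a b. block P C a b \<and> (x = a \<or> x = b)"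
proof -
  have C: "C \<in> finite_chains P" "even (card C)" using assms by (auto simp: even_chains_eq)
  obtain xs where xs: "chain_enum P C xs" using chain_enum_exists C by blast
  then obtain i where i: "i < length xs" "x = xs ! i"
    using assms(2) by (metis chain_enum_def in_set_conv_nth)
  have "even (length xs)" using chain_enum_length [OF xs] C by simp
  then have "i div 2 < length xs div 2" using i by auto
  then have "block P C (xs ! (2 * (i div 2))) (xs ! (2 * (i div 2) + 1))"
    using block_iff_nth [OF C xs] by blast
  moreover have "i = 2 * (i div 2) \<or> i = 2 * (i div 2) + 1" by auto
  ultimately show ?thesis using i by metis
qed

lemma inside_iff_block:
  assumes "C \<in> even_chains P"
  shows "inside P C z \<longleftrightarrow> (\<exists>a b. block P C a b \<and> (a, z) \<in> le P \<and> (b, z) \<notin> le P)"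
proof -
  have C: "C \<in> finite_chains P" "even (card C)" using assms by (auto simp: even_chains_eq)
  obtain xs where xs: "chain_enum P C xs" using chain_enum_exists C by blast
  have ev: "even (length xs)" using chain_enum_length [OF xs] C by simp
  let ?k = "card {x \<in> C. (x, z) \<in> le P}"
  have len: "?k \<le> length xs"
    unfolding chain_enum_length [OF xs]
    using C finite_chains_finite by (intro card_mono) auto
  have "odd ?k \<longleftrightarrow> (\<exists>i < length xs div 2. 2 * i < ?k \<and> \<not> 2 * i + 1 < ?k)"
  proof
    assume "odd ?k"
    then have "?k div 2 < length xs div 2 \<and> 2 * (?k div 2) < ?k \<and> \<not> 2 * (?k div 2) + 1 < ?k"
      using len ev by presburger
    then show "\<exists>i < length xs div 2. 2 * i < ?k \<and> \<not> 2 * i + 1 < ?k" by blast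
  next
    assume "\<exists>i < length xs div 2. 2 * i < ?k \<and> \<not> 2 * i + 1 < ?k"
    then obtain i where "2 * i < ?k" "\<not> 2 * i + 1 < ?k" by blast
    then have "?k = 2 * i + 1" by linarith
    then show "odd ?k" by simp
  qed
  also have "\<dots> \<longleftrightarrow> (\<exists>i < length xs div 2. (xs ! (2 * i), z) \<in> le P \<and> (xs ! (2 * i + 1), z) \<notin> le P)"
    using chain_enum_nth_below_iff [OF xs, of _ z]
    by (intro ex_cong1 conj_cong) auto
  also have "\<dots> \<longleftrightarrow> (\<exists>a b. block P C a b \<and> (a, z) \<in> le P \<and> (b, z) \<notin> le P)"
    using block_iff_nth [OF C xs] by metis
  finally show ?thesis by (simp add: inside_def)
qed

lemma block_end_not_inside:
  assumes "C \<in> even_chains P" "block P C a b"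
  shows "\<not> inside P C b"
proof -
  have C: "C \<in> finite_chains P" "even (card C)" using assms by (auto simp: even_chains_eq)
  obtain xs where xs: "chain_enum P C xs" using chain_enum_exists C by blast
  obtain i where i: "i < length xs div 2" "b = xs ! (2 * i + 1)"
    using assms block_iff_nth [OF C xs] by blast
  then have "2 * i + 1 < length xs" by simp
  from chain_enum_inside_nth [OF C(1) xs this] i show ?thesis by simp
qed

text \<open>
  If \<open>C \<le> D\<close>, each point of \<open>C\<close> lies between the ends of a block of \<open>D\<close>. Since these ends are
  neighbours in \<open>D\<close>, the point is comparable with every element of \<open>D\<close>.
\<close>

lemma kalmbach_le_imp:
  assumes "(C, D) \<in> kalmbach_le P"
  shows "C \<union> D \<in> finite_chains P" and "inside P C z \<Longrightarrow> inside P D z"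
proof -
  have C: "C \<in> even_chains P" and D: "D \<in> even_chains P"
    and nested: "\<And>a b. block P C a b \<Longrightarrow> \<exists>c d. block P D c d \<and> (c, a) \<in> le P \<and> (b, d) \<in> le P"
    using assms by (auto simp: kalmbach_le_iff_blocks)
  have cmp: "(x, y) \<in> le P \<or> (y, x) \<in> le P" if x: "x \<in> C" and y: "y \<in> D" for x y
  proof -
    obtain a b where ab: "block P C a b" "x = a \<or> x = b"
      using even_chain_covered_by_blocks [OF C x] by blast
    obtain c d where cd: "block P D c d" "(c, a) \<in> le P" "(b, d) \<in> le P"
      using nested ab by blast
    have "(a, b) \<in> le P" using ab by (simp add: block_def)
    then have "(c, x) \<in> le P" "(x, d) \<in> le P" using ab cd le_trans by blast+
    moreover have "(y, c) \<in> le P \<or> (d, y) \<in> le P" using cd y by (simp add: block_def)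
    ultimately show ?thesis using le_trans by blast
  qed
  have "C \<in> finite_chains P" "D \<in> finite_chains P" using C D by (auto simp: even_chains_eq)
  with cmp show "C \<union> D \<in> finite_chains P"
    by (auto simp: finite_chains_def Chains_def)
  show "inside P D z" if ins: "inside P C z"
  proof -
    obtain a b where ab: "block P C a b" "(a, z) \<in> le P" "(b, z) \<notin> le P"
      using ins inside_iff_block [OF C] by blast
    then obtain c d where cd: "block P D c d" "(c, a) \<in> le P" "(b, d) \<in> le P"
      using nested by blast
    then have "(c, z) \<in> le P" "(d, z) \<notin> le P" using ab le_trans by blast+
    then show ?thesis using cd inside_iff_block [OF D] by blast
  qed
qed

text \<open>
  A block \<open>[a < b]\<close> of \<open>C\<close> starts inside \<open>D\<close>, hence in some block \<open>[c < d]\<close> of \<open>D\<close>. It cannot outlast that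
  block: otherwise \<open>d\<close> would be inside \<open>C\<close> without being inside \<open>D\<close>. Comparability of \<open>d\<close> with \<open>a\<close> and
  \<open>b\<close> is essential here.
\<close>

lemma kalmbach_leI:
  assumes C: "C \<in> even_chains P" and D: "D \<in> even_chains P"
    and chain: "C \<union> D \<in> finite_chains P"
    and ins: "\<And>z. z \<in> C \<union> D \<Longrightarrow> inside P C z \<Longrightarrow> inside P D z"
  shows "(C, D) \<in> kalmbach_le P"
proof -
  have "\<exists>c d. block P D c d \<and> (c, a) \<in> le P \<and> (b, d) \<in> le P" if ab: "block P C a b" for a b
  proof -
    have in_C: "a \<in> C" "b \<in> C" "inside P C a" using ab by (auto simp: block_def)
    with ins obtain c d where cd: "block P D c d" "(c, a) \<in> le P" "(d, a) \<notin> le P"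
      using inside_iff_block [OF D] by blast
    have "d \<in> D" using cd by (simp add: block_def)
    have "(a, d) \<in> le P"
      using finite_chains_total [OF chain, of a d] in_C \<open>d \<in> D\<close> cd by blast
    have "(b, d) \<in> le P"
    proof (rule ccontr)
      assume "(b, d) \<notin> le P"
      \<comment> \<open>The block \<open>[a < b]\<close> contains \<open>d\<close>, where the block of \<open>D\<close> has just ended.\<close>
      then have "inside P C d" using ab \<open>(a, d) \<in> le P\<close> inside_iff_block [OF C] by blast
      then have "inside P D d" using ins \<open>d \<in> D\<close> by blast
      then show False using block_end_not_inside [OF D cd(1)] by blast
    qed
    then show ?thesis using cd by blast
  qed
  then show ?thesis using C D by (simp add: kalmbach_le_iff_blocks)
qed


text \<open>
  A point above \<open>m\<close> is above all of \<open>B\<close>, an even number of elements, so it is not inside \<open>B\<close>; and the points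
  not above \<open>m\<close> are exactly those inside \<open>[0 < m]\<close>.
\<close>

lemma even_chain_le_pair:
  assumes B: "B \<in> even_chains P" and m: "m \<in> carrier P" and ub: "\<And>b. b \<in> B \<Longrightarrow> (b, m) \<in> le P"
  shows "(B, sym_diff {bot_el P} {m}) \<in> kalmbach_le P"
proof (rule kalmbach_leI [OF B])
  show "sym_diff {bot_el P} {m} \<in> even_chains P" using bot_le [OF m] by (rule pair_even_chain)
  have bm: "(c, m) \<in> le P" if "c \<in> insert (bot_el P) B" for c
    using that ub bot_le [OF m] by auto
  have "insert (bot_el P) B \<in> finite_chains P"
    using B bot_le bot_carrier le_refl
    by (auto simp: even_chains_def finite_chains_def Chains_def)
  then have "insert m (insert (bot_el P) B) \<in> finite_chains P"
    by (rule finite_chains_insert [OF _ m bm])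
  then show "B \<union> sym_diff {bot_el P} {m} \<in> finite_chains P"
    by (rule finite_chains_subset) auto
  fix z assume z: "z \<in> B \<union> sym_diff {bot_el P} {m}" "inside P B z"
  have "(bot_el P, z) \<in> le P"
    using z(1) B m bot_carrier by (intro bot_le) (auto simp: even_chains_def)
  moreover have "(m, z) \<notin> le P"
  proof
    assume "(m, z) \<in> le P"
    then have "inside P B z \<longleftrightarrow> odd (card B)" using ub le_trans by (intro inside_upper_bound) blast
    with z B show False by (simp add: even_chains_eq)
  qed
  ultimately show "inside P (sym_diff {bot_el P} {m}) z" unfolding inside_pair by blast
qed

lemma pair_le_pair:
  assumes "(a, b) \<in> le P" "(b, c) \<in> le P"
  shows "(sym_diff {b} {c}, sym_diff {a} {c}) \<in> kalmbach_le P"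
proof (rule kalmbach_leI)
  have ac: "(a, c) \<in> le P" using assms le_trans by blast
  show "sym_diff {b} {c} \<in> even_chains P" using assms(2) by (rule pair_even_chain)
  show "sym_diff {a} {c} \<in> even_chains P" using ac by (rule pair_even_chain)
  have "{a, b, c} \<in> finite_chains P"
    using assms ac le_carrier le_refl by (auto simp: finite_chains_def Chains_def)
  then show "sym_diff {b} {c} \<union> sym_diff {a} {c} \<in> finite_chains P"
    by (rule finite_chains_subset) auto
  show "inside P (sym_diff {a} {c}) z" if "inside P (sym_diff {b} {c}) z" for z
    using that assms ac le_trans unfolding inside_pair by blast
qed

text \<open>
  The least element of a nonempty chain is inside it.
\<close>

lemma never_inside_imp_empty:
  assumes "C \<in> finite_chains P" "\<And>z. \<not> inside P C z"
  shows "C = {}"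
proof -
  obtain xs where xs: "chain_enum P C xs" using chain_enum_exists assms by blast
  have "xs = []"
    using chain_enum_inside_nth [OF assms(1) xs, of 0] assms(2) by auto
  then show ?thesis using xs by (simp add: chain_enum_def)
qed

lemma is_bposet_T: "is_bposet (T P)"
proof -
  have refl: "(C, C) \<in> kalmbach_le P" if "C \<in> even_chains P" for C
  proof -
    have "(a, a) \<in> le P \<and> (b, b) \<in> le P" if "block P C a b" for a b
      using that le_carrier le_refl unfolding block_def by blast
    then show ?thesis using that unfolding kalmbach_le_iff_blocks by blast
  qed
  have "trans (kalmbach_le P)"
  proof (rule transI)
    fix B C D assume "(B, C) \<in> kalmbach_le P" "(C, D) \<in> kalmbach_le P"
    then show "(B, D) \<in> kalmbach_le P"
      unfolding kalmbach_le_iff_blocks using le_trans by meson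
  qed
  moreover have "antisym (kalmbach_le P)"
  proof (rule antisymI)
    fix C D assume CD: "(C, D) \<in> kalmbach_le P" "(D, C) \<in> kalmbach_le P"
    then have "finite C" "finite D"
      using kalmbach_le_imp(1) [OF CD(1)] finite_chains_finite by blast+
    \<comment> \<open>The same points are inside \<open>C\<close> and \<open>D\<close>, so none is inside \<open>C \<Delta> D\<close>.\<close>
    then have "\<not> inside P (sym_diff C D) z" for z
      unfolding inside_sym_diff [OF \<open>finite C\<close> \<open>finite D\<close>]
      using kalmbach_le_imp(2) CD by blast
    moreover have "sym_diff C D \<in> finite_chains P"
      using kalmbach_le_imp(1) [OF CD(1)] by (rule finite_chains_subset) auto
    ultimately have "sym_diff C D = {}" by (intro never_inside_imp_empty)
    then show "C = D" by auto
  qed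
  moreover have "refl_on (even_chains P) (kalmbach_le P)"
    using refl by (simp add: refl_on_def)
  moreover have "kalmbach_le P \<subseteq> even_chains P \<times> even_chains P"
    by (auto simp: kalmbach_le_def)
  ultimately have "partial_order_on (even_chains P) (kalmbach_le P)"
    by (simp add: partial_order_on_def preorder_on_def)
  moreover have empty: "{} \<in> even_chains P" by (simp add: even_chains_eq finite_chains_empty)
  moreover have "({}, C) \<in> kalmbach_le P" if "C \<in> even_chains P" for C
    using that empty by (simp add: kalmbach_le_iff_blocks block_def)
  moreover have "sym_diff {bot_el P} {top_el P} \<in> even_chains P"
    using bot_le [OF top_carrier] by (rule pair_even_chain)
  moreover have "(C, sym_diff {bot_el P} {top_el P}) \<in> kalmbach_le P" if "C \<in> even_chains P" for C
    using that top_carrier by (intro even_chain_le_pair) (auto simp: even_chains_def le_top)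
  ultimately show ?thesis unfolding is_bposet_def T_sel by blast
qed

text \<open>
  All unions of two members of \<open>X \<union> {M}\<close> are chains, so the union of all members is a chain; and a point
  inside the symmetric difference is inside some member, hence inside \<open>M\<close>.
\<close>

lemma Sym_Diff_kalmbach_le:
  assumes X: "X \<in> finite_chains (T P)" and M: "M \<in> even_chains P"
    and ub: "\<And>C. C \<in> X \<Longrightarrow> (C, M) \<in> kalmbach_le P"
  shows "(Sym_Diff (\<lambda>C. C) X, M) \<in> kalmbach_le P"
proof (rule kalmbach_leI [OF _ M])
  have fin: "finite X" using X by (rule finite_chains_finite)
  have ev: "C \<in> even_chains P" if "C \<in> X" for C using X that finite_chains_carrier by fastforce
  have cmp: "(x, y) \<in> le P \<or> (y, x) \<in> le P"
    if "x \<in> C" "y \<in> D" and CD: "C \<in> insert M X" "D \<in> insert M X" for x y C D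
  proof -
    have "(M, M) \<in> le (T P)"
      using M is_bposet_T by (intro bounded_poset.le_refl) (auto simp: bounded_poset_def)
    then have "(C, D) \<in> kalmbach_le P \<or> (D, C) \<in> kalmbach_le P"
      using CD ub finite_chains_total [OF X, of C D] by auto
    then have "C \<union> D \<in> finite_chains P"
      using kalmbach_le_imp(1) by (metis Un_commute)
    then show ?thesis using finite_chains_total [of "C \<union> D" P x y] that(1,2) by blast
  qed
  have "finite (\<Union>(insert M X))" "\<Union>(insert M X) \<subseteq> carrier P"
    using fin ev M by (auto simp: even_chains_def)
  then have U: "\<Union>(insert M X) \<in> finite_chains P"
    using cmp unfolding finite_chains_def Chains_def by blast
  have sub: "Sym_Diff (\<lambda>C. C) X \<union> M \<subseteq> \<Union>(insert M X)"
    using Sym_Diff_subset [OF fin, of "\<lambda>C. C"] by auto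
  show chain: "Sym_Diff (\<lambda>C. C) X \<union> M \<in> finite_chains P"
    using finite_chains_subset [OF U sub] .
  have "even (card (Sym_Diff (\<lambda>C. C) X))"
    using fin ev by (intro even_card_Sym_Diff) (auto simp: even_chains_def)
  then show "Sym_Diff (\<lambda>C. C) X \<in> even_chains P"
    using finite_chains_subset [OF chain] by (auto simp: even_chains_eq)
  show "inside P M z" if ins: "inside P (Sym_Diff (\<lambda>C. C) X) z" for z
  proof -
    obtain C where "C \<in> X" "inside P C z"
      using inside_Sym_Diff [OF fin _ ins] ev by (auto simp: even_chains_def)
    then show ?thesis using ub kalmbach_le_imp(2) by blast
  qed
qed

text \<open>
  In this form the unit needs no case distinction, as \<open>[0] \<Delta> [0]\<close> is already empty.
\<close>

lemma eta_eq: "a \<in> carrier P \<Longrightarrow> \<eta> P a = sym_diff {bot_el P} {a}"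
  by (auto simp: \<eta>_def)

end


section \<open>Effect algebras and alternating differences\<close>

definition ea_poset :: "'a effect_algebra \<Rightarrow> 'a bposet" where
  "ea_poset E = \<lparr> carrier = ea_carrier E, le = {(a, b). \<exists>c. ea_plus E a c = Some b},
     bot_el = ea_zero E, top_el = ea_one E \<rparr>"

definition ea_diff :: "'a effect_algebra \<Rightarrow> 'a \<Rightarrow> 'a \<Rightarrow> 'a" where
  "ea_diff E b a = (THE c. ea_plus E a c = Some b)"

text \<open>
  The structure map \<open>\<alpha>\<close> of the Kalmbach algebra, as a fold of subtraction over the increasing
  enumeration. It is used for chains with an odd number of elements, too, because intermediate stages
  of every recursion over chains are of that kind.
\<close>

definition ea_alt :: "'a effect_algebra \<Rightarrow> 'a set \<Rightarrow> 'a" where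
  "ea_alt E C = foldl (\<lambda>r x. ea_diff E x r) (ea_zero E) (SOME xs. chain_enum (ea_poset E) C xs)"

lemma ea_poset_sel [simp]:
  "carrier (ea_poset E) = ea_carrier E"
  "(a, b) \<in> le (ea_poset E) \<longleftrightarrow> (\<exists>c. ea_plus E a c = Some b)"
  "bot_el (ea_poset E) = ea_zero E" "top_el (ea_poset E) = ea_one E"
  by (simp_all add: ea_poset_def)

locale eff_alg =
  fixes E :: "'a effect_algebra"
  assumes effect_algebra: "is_effect_algebra E"
begin

abbreviation sums :: "'a \<Rightarrow> 'a \<Rightarrow> 'a \<Rightarrow> bool" where
  "sums a b c \<equiv> ea_plus E a b = Some c"

abbreviation zero ("\<zero>") where "\<zero> \<equiv> ea_zero E"
abbreviation one ("\<one>") where "\<one> \<equiv> ea_one E"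

lemma zero_carrier: "\<zero> \<in> ea_carrier E"
  using effect_algebra unfolding is_effect_algebra_def by (elim conjE)

lemma one_carrier: "\<one> \<in> ea_carrier E"
  using effect_algebra unfolding is_effect_algebra_def by (elim conjE)

lemma sums_carrier: "sums a b c \<Longrightarrow> a \<in> ea_carrier E \<and> b \<in> ea_carrier E \<and> c \<in> ea_carrier E"
  using effect_algebra unfolding is_effect_algebra_def by (elim conjE) iprover

lemma sums_commute: "sums a b c \<Longrightarrow> sums b a c"
  using effect_algebra unfolding is_effect_algebra_def by (elim conjE) iprover

lemma sums_assoc: "sums a b d \<Longrightarrow> sums d c e \<Longrightarrow> \<exists>f. sums b c f \<and> sums a f e"
  using effect_algebra unfolding is_effect_algebra_def by (elim conjE) iprover

lemma complement: "a \<in> ea_carrier E \<Longrightarrow> \<exists>!a'. a' \<in> ea_carrier E \<and> sums a a' \<one>"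
  using effect_algebra unfolding is_effect_algebra_def by (elim conjE) (erule bspec)

lemma sums_one:
  assumes "sums a \<one> c"
  shows "a = \<zero>"
proof -
  have "\<forall>a \<in> ea_carrier E. ea_plus E a \<one> \<noteq> None \<longrightarrow> a = \<zero>"
    using effect_algebra unfolding is_effect_algebra_def by (elim conjE)
  then show ?thesis using assms sums_carrier [OF assms] by simp
qed

lemma sums_zero:
  assumes a: "a \<in> ea_carrier E"
  shows "sums a \<zero> a"
proof -
  obtain z where z: "sums \<one> z \<one>" using complement [OF one_carrier] by blast
  then have "z = \<zero>" using sums_commute sums_one by blast
  with z have one: "sums \<one> \<zero> \<one>" by simp
  obtain a' where a': "sums a a' \<one>" using complement [OF a] by blast
  from sums_assoc [OF sums_commute [OF a'] one]
  obtain f where f: "sums a \<zero> f" "sums a' f \<one>" by blast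
  moreover have "f = a"
    using complement [of a'] f a' sums_commute sums_carrier by blast
  ultimately show ?thesis by simp
qed

text \<open>
  Completing \<open>a \<oplus> b = a \<oplus> c\<close> to \<open>\<one>\<close> by a common \<open>d'\<close> exhibits \<open>b\<close> and \<open>c\<close> as orthosupplements of the same
  element \<open>a \<oplus> d'\<close>.
\<close>

lemma sums_cancel:
  assumes "sums a b d" "sums a c d"
  shows "b = c"
proof -
  obtain d' where d': "sums d d' \<one>"
    using complement [of d] sums_carrier [OF assms(1)] by blast
  obtain g where g: "sums a d' g" "sums b g \<one>"
    using sums_assoc [OF sums_commute [OF assms(1)] d'] by blast
  obtain h where h: "sums a d' h" "sums c h \<one>"
    using sums_assoc [OF sums_commute [OF assms(2)] d'] by blast
  have gb: "sums g b \<one>" using g(2) sums_commute by blast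
  have gc: "sums g c \<one>" using g(1) h(1) sums_commute [OF h(2)] by simp
  show ?thesis
    using complement [of g] sums_carrier [OF gb] sums_carrier [OF gc] gb gc by blast
qed

lemma sums_eq_zero:
  assumes "sums a b \<zero>"
  shows "a = \<zero>"
proof -
  have "sums \<zero> \<one> \<one>" using sums_zero [OF one_carrier] sums_commute by blast
  with sums_assoc [OF sums_commute [OF assms]] show ?thesis using sums_one by blast
qed

lemma is_bposet_ea_poset: "is_bposet (ea_poset E)"
proof -
  let ?r = "le (ea_poset E)"
  have "trans ?r"
  proof (rule transI)
    fix x y z assume "(x, y) \<in> ?r" "(y, z) \<in> ?r"
    then obtain c d where "sums x c y" "sums y d z" by auto
    from sums_assoc [OF this] show "(x, z) \<in> ?r" by auto
  qed
  moreover have "antisym ?r"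
  proof (rule antisymI)
    fix x y assume "(x, y) \<in> ?r" "(y, x) \<in> ?r"
    then obtain c d where cd: "sums x c y" "sums y d x" by auto
    from sums_assoc [OF cd] obtain f where f: "sums c d f" "sums x f x" by blast
    then have "f = \<zero>" using sums_cancel sums_zero sums_carrier by blast
    then have "c = \<zero>" using f sums_eq_zero by blast
    then show "x = y" using cd(1) sums_zero [of x] sums_carrier [OF cd(1)] by simp
  qed
  moreover have "refl_on (ea_carrier E) ?r" using sums_zero by (auto simp: refl_on_def)
  moreover have "?r \<subseteq> ea_carrier E \<times> ea_carrier E" using sums_carrier by auto
  ultimately have "partial_order_on (ea_carrier E) ?r"
    by (simp add: partial_order_on_def preorder_on_def)
  moreover have "(\<zero>, x) \<in> ?r" if "x \<in> ea_carrier E" for x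
    using sums_commute [OF sums_zero [OF that]] by auto
  moreover have "(x, \<one>) \<in> ?r" if "x \<in> ea_carrier E" for x
    using complement [OF that] by auto
  ultimately show ?thesis by (simp add: is_bposet_def zero_carrier one_carrier del: ea_poset_sel(2))
qed

sublocale bounded_poset "ea_poset E"
  by unfold_locales (rule is_bposet_ea_poset)

abbreviation leq (infix "\<sqsubseteq>" 50) where "a \<sqsubseteq> b \<equiv> (a, b) \<in> le (ea_poset E)"
abbreviation diff (infixl "\<ominus>" 65) where "b \<ominus> a \<equiv> ea_diff E b a"
abbreviation chains where "chains \<equiv> finite_chains (ea_poset E)"
abbreviation alt where "alt \<equiv> ea_alt E"

lemma diff_eq: "sums a c b \<Longrightarrow> b \<ominus> a = c"
  unfolding ea_diff_def using sums_cancel by blast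

lemma sums_diff: "a \<sqsubseteq> b \<Longrightarrow> sums a (b \<ominus> a) b"
  using diff_eq by fastforce

lemma diff_le: "a \<sqsubseteq> b \<Longrightarrow> b \<ominus> a \<sqsubseteq> b"
  using sums_commute [OF sums_diff] by simp blast

lemma diff_diff: "a \<sqsubseteq> b \<Longrightarrow> b \<ominus> (b \<ominus> a) = a"
  using sums_diff sums_commute diff_eq by blast

lemma diff_zero: "a \<in> ea_carrier E \<Longrightarrow> a \<ominus> \<zero> = a"
  using sums_zero sums_commute diff_eq by blast

lemma alt_enum:
  assumes "chain_enum (ea_poset E) C xs"
  shows "alt C = foldl (\<lambda>r x. x \<ominus> r) \<zero> xs"
proof -
  have "(SOME xs. chain_enum (ea_poset E) C xs) = xs"
    using assms chain_enum_unique by blast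
  then show ?thesis by (simp add: ea_alt_def)
qed

lemma alt_empty: "alt {} = \<zero>"
  using alt_enum [of "{}" "[]"] by (simp add: chain_enum_def)

lemma alt_insert:
  assumes "C \<in> chains" "m \<notin> C" "\<And>c. c \<in> C \<Longrightarrow> c \<sqsubseteq> m"
  shows "alt (insert m C) = m \<ominus> alt C"
proof -
  obtain xs where xs: "chain_enum (ea_poset E) C xs" using chain_enum_exists assms by blast
  then have "chain_enum (ea_poset E) (insert m C) (xs @ [m])"
    using assms(2,3) by (auto simp: chain_enum_def sorted_wrt_append)
  with xs show ?thesis by (simp add: alt_enum)
qed

lemma alt_le:
  assumes "C \<in> chains" "m \<in> ea_carrier E" "\<And>c. c \<in> C \<Longrightarrow> c \<sqsubseteq> m"
  shows "alt C \<sqsubseteq> m"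
  using assms
proof (induction arbitrary: m rule: finite_chain_induct)
  case empty
  then show ?case using bot_le [of m] unfolding alt_empty by simp
next
  case (insert x C)
  have "alt C \<sqsubseteq> x" using insert by (simp del: ea_poset_sel(2))
  then have "x \<ominus> alt C \<sqsubseteq> x" by (rule diff_le)
  moreover have "x \<sqsubseteq> m" using insert.prems by blast
  moreover have "alt (insert x C) = x \<ominus> alt C"
    by (rule alt_insert [OF insert.hyps(1,3,4)])
  ultimately show ?case using le_trans by metis
qed

text \<open>
  Subtracting from a maximum that is already present removes it again, because
  \<open>m \<ominus> (m \<ominus> r) = r\<close>; this is why cancellation in symmetric differences agrees with subtraction.
\<close>

lemma alt_toggle_max:
  assumes S: "S \<in> chains" and m: "m \<in> ea_carrier E" and ub: "\<And>s. s \<in> S \<Longrightarrow> s \<sqsubseteq> m"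
  shows "alt (sym_diff {m} S) = m \<ominus> alt S"
proof (cases "m \<in> S")
  case False
  then have "sym_diff {m} S = insert m S" by auto
  then show ?thesis using alt_insert [OF S False ub] by (simp only:)
next
  case True
  have S': "S - {m} \<in> chains" using S by (rule finite_chains_subset) auto
  have "S = insert m (S - {m})" using True by auto
  then have "alt S = m \<ominus> alt (S - {m})"
    using alt_insert [OF S', of m] ub by (metis Diff_iff insertI1)
  moreover have "alt (S - {m}) \<sqsubseteq> m" using S' m ub by (intro alt_le) auto
  moreover have "sym_diff {m} S = S - {m}" using True by auto
  ultimately show ?thesis using diff_diff by (simp only:)
qed

lemma alt_singleton: "a \<in> ea_carrier E \<Longrightarrow> alt {a} = a"
  using alt_insert [OF finite_chains_empty, of a] diff_zero by (simp add: alt_empty)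

lemma alt_pair:
  assumes "a \<sqsubseteq> b"
  shows "alt (sym_diff {a} {b}) = b \<ominus> a"
proof -
  have ab: "a \<in> ea_carrier E" "b \<in> ea_carrier E" using le_carrier [OF assms] by simp_all
  have "{a} \<in> chains" using ab(1) le_refl by (auto simp: finite_chains_def Chains_def)
  from alt_toggle_max [OF this ab(2)] assms ab
  have "alt (sym_diff {b} {a}) = b \<ominus> a" by (simp only: alt_singleton) blast
  moreover have "sym_diff {b} {a} = sym_diff {a} {b}" by (rule Un_commute)
  ultimately show ?thesis by (simp only:)
qed

text \<open>
  The total length of the part of the region inside \<open>C\<close> that lies below an upper bound \<open>w\<close> of \<open>C\<close>. For an
  odd chain the last element opens a block that reaches up to \<open>w\<close>, and since the alternating
  difference is then that element minus the mass of the finished blocks, subtracting it from \<open>w\<close>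
  gives the finished blocks together with the open one.
\<close>

definition mass :: "'a set \<Rightarrow> 'a \<Rightarrow> 'a" where
  "mass C w = (if even (card C) then alt C else w \<ominus> alt C)"

text \<open>
  A block that opens or closes at \<open>m\<close> itself has contributed the same length below \<open>m\<close> as if \<open>m\<close> were not
  in the chain.
\<close>

lemma mass_remove_max:
  assumes C: "C \<in> chains" and m: "m \<in> ea_carrier E" and ub: "\<And>c. c \<in> C \<Longrightarrow> c \<sqsubseteq> m"
  shows "mass C m = mass (C - {m}) m"
proof (cases "m \<in> C")
  case True
  have C': "C - {m} \<in> chains" using C by (rule finite_chains_subset) auto
  have "C = insert m (C - {m})" using True by auto
  then have "alt C = m \<ominus> alt (C - {m})"
    using alt_insert [OF C', of m] ub by (metis Diff_iff insertI1)
  moreover have "alt (C - {m}) \<sqsubseteq> m" using C' m ub by (intro alt_le) auto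
  moreover have "card C = Suc (card (C - {m}))"
    using C True finite_chains_finite by (metis card.remove)
  ultimately show ?thesis by (auto simp: mass_def diff_diff simp del: ea_poset_sel(2))
qed simp

text \<open>
  While a block is open, moving the bound from \<open>m\<close> to \<open>w\<close> adds the length \<open>w \<ominus> m\<close>.
\<close>

lemma mass_raise:
  assumes C: "C \<in> chains" and ub: "\<And>c. c \<in> C \<Longrightarrow> c \<sqsubseteq> m" and mw: "m \<sqsubseteq> w" and odd: "odd (card C)"
  shows "sums (mass C m) (w \<ominus> m) (mass C w)"
proof -
  have "alt C \<sqsubseteq> m" using C ub le_carrier(1) [OF mw] by (intro alt_le) auto
  then have "sums (alt C) (mass C m) m" using sums_diff odd by (simp add: mass_def)
  from sums_assoc [OF this sums_diff [OF mw]]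
  obtain f where f: "sums (mass C m) (w \<ominus> m) f" "sums (alt C) f w" by blast
  then have "mass C w = f" using diff_eq odd by (simp add: mass_def)
  with f show ?thesis by simp
qed

lemma mass_raise_even: "even (card C) \<Longrightarrow> mass C w = mass C m"
  by (simp add: mass_def)

text \<open>
  Additivity of mass, scanning a common chain \<open>W\<close> upwards. Between consecutive points of \<open>W\<close> each of the
  three masses either stays or grows by the same length, according to whether the step is inside the
  chain. As points inside \<open>D\<close> are inside \<open>C\<close>, a step inside \<open>C\<close> is inside exactly one of \<open>D\<close> and \<open>C \<Delta> D\<close>,
  so both sides of the equation always grow together. Working with mass rather than \<open>alt\<close> keeps
  the statement uniform in the parities of the chains, which change at each step.
\<close>

lemma mass_additive:
  assumes "W \<in> chains" "w \<in> ea_carrier E" "\<And>z. z \<in> W \<Longrightarrow> z \<sqsubseteq> w" "C \<subseteq> W" "D \<subseteq> W"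
    and "\<And>z. z \<in> W \<Longrightarrow> inside (ea_poset E) D z \<Longrightarrow> inside (ea_poset E) C z"
  shows "sums (mass (sym_diff C D) w) (mass D w) (mass C w)"
  using assms
proof (induction arbitrary: w C D rule: finite_chain_induct)
  case empty
  then have "C = {}" "D = {}" by auto
  then show ?case using sums_zero zero_carrier by (simp add: mass_def alt_empty)
next
  case (insert m W)
  let ?P = "ea_poset E" and ?S = "sym_diff C D"
  have mW: "insert m W \<in> chains" by (rule finite_chains_insert [OF insert.hyps(1,2,4)])
  have chains: "C \<in> chains" "D \<in> chains" "?S \<in> chains"
    using insert.prems(3,4) by (auto intro: finite_chains_subset [OF mW])
  have fin: "finite C" "finite D" using chains finite_chains_finite by auto
  have ub: "z \<sqsubseteq> m" if "z \<in> insert m W" for z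
    using that insert.hyps(2,4) le_refl by blast
  have ubC: "\<And>z. z \<in> C \<Longrightarrow> z \<sqsubseteq> m" and ubD: "\<And>z. z \<in> D \<Longrightarrow> z \<sqsubseteq> m"
    and ubS: "\<And>z. z \<in> ?S \<Longrightarrow> z \<sqsubseteq> m"
    using ub insert.prems(3,4) by blast+
  have m: "m \<in> ea_carrier E" using insert.hyps(2) by simp
  have mw: "m \<sqsubseteq> w" using insert.prems(2) by blast
  have remove: "inside ?P (B - {m}) z \<longleftrightarrow> inside ?P B z" if "z \<in> W" for B z
  proof -
    have "\<not> m \<sqsubseteq> z" using that insert.hyps(3,4) le_antisym by blast
    then have "{x \<in> B - {m}. x \<sqsubseteq> z} = {x \<in> B. x \<sqsubseteq> z}" by auto
    then show ?thesis by (simp only: inside_def)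
  qed
  have "sums (mass (sym_diff (C - {m}) (D - {m})) m) (mass (D - {m}) m) (mass (C - {m}) m)"
    using insert.prems(3,4,5) insert.hyps(4) m remove by (intro insert.IH) blast+
  moreover have "sym_diff (C - {m}) (D - {m}) = ?S - {m}" by auto
  ultimately have at_m: "sums (mass ?S m) (mass D m) (mass C m)"
    using mass_remove_max [OF chains(1) m ubC] mass_remove_max [OF chains(2) m ubD]
      mass_remove_max [OF chains(3) m ubS] by (simp only:)
  \<comment> \<open>The step from \<open>m\<close> to \<open>w\<close> is inside a chain iff \<open>m\<close> is, that is, iff the chain is odd.\<close>
  have inC: "inside ?P C m \<longleftrightarrow> odd (card C)" and inD: "inside ?P D m \<longleftrightarrow> odd (card D)"
    using ubC ubD by (intro inside_upper_bound; blast)+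
  have parS: "even (card ?S) \<longleftrightarrow> (even (card C) \<longleftrightarrow> even (card D))"
    using fin by (rule even_card_sym_diff)
  have imp: "odd (card D) \<Longrightarrow> odd (card C)" using insert.prems(5) [of m] inC inD by blast
  consider "even (card C)" "even (card D)" | "odd (card C)" "even (card D)"
    | "odd (card C)" "odd (card D)" using imp by blast
  then show ?case
  proof cases
    case 1
    then show ?thesis
      using at_m mass_raise_even [of _ w m] parS by metis
  next
    case 2
    then have S: "odd (card ?S)" using parS by blast
    obtain f where "sums (mass ?S m) (w \<ominus> m) f" "sums (mass D m) f (mass C w)"
      using sums_assoc [OF sums_commute [OF at_m] mass_raise [OF chains(1) ubC mw 2(1)]] by blast
    moreover from this(1) have "f = mass ?S w"
      using mass_raise [OF chains(3) ubS mw S] by simp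
    ultimately show ?thesis using mass_raise_even [OF 2(2), of w m] sums_commute by metis
  next
    case 3
    then have S: "even (card ?S)" using parS by blast
    obtain f where "sums (mass D m) (w \<ominus> m) f" "sums (mass ?S m) f (mass C w)"
      using sums_assoc [OF at_m mass_raise [OF chains(1) ubC mw 3(1)]] by blast
    moreover from this(1) have "f = mass D w"
      using mass_raise [OF chains(2) ubD mw 3(2)] by simp
    ultimately show ?thesis using mass_raise_even [OF S, of w m] by metis
  qed
qed

text \<open>
  The case of even chains, where no block is open and mass is the alternating difference.
\<close>

lemma alt_additive:
  assumes "(D, C) \<in> kalmbach_le (ea_poset E)"
  shows "sums (alt (sym_diff C D)) (alt D) (alt C)"
proof -
  have ev: "even (card C)" "even (card D)"
    using assms by (auto simp: kalmbach_le_def even_chains_def)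
  have ch: "D \<union> C \<in> chains" using assms by (rule kalmbach_le_imp(1))
  then have "finite C" "finite D" using finite_chains_finite by auto
  then have evS: "even (card (sym_diff C D))" using ev even_card_sym_diff by blast
  have "sums (mass (sym_diff C D) \<one>) (mass D \<one>) (mass C \<one>)"
    using ch
  proof (rule mass_additive)
    show "z \<sqsubseteq> \<one>" if "z \<in> D \<union> C" for z
      using le_top [of z] finite_chains_carrier [OF ch that] by simp
  qed (use kalmbach_le_imp(2) [OF assms] one_carrier in auto)
  then show ?thesis using ev evS by (simp only: mass_def if_True)
qed

lemma alt_mono:
  assumes "(D, C) \<in> kalmbach_le (ea_poset E)"
  shows "alt D \<sqsubseteq> alt C"
  using sums_commute [OF alt_additive [OF assms]] by (simp, blast)

lemma alt_carrier:
  assumes "C \<in> chains"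
  shows "alt C \<in> ea_carrier E"
proof -
  have "c \<sqsubseteq> \<one>" if "c \<in> C" for c
    using le_top [OF finite_chains_carrier [OF assms that]] by (simp only: ea_poset_sel(4))
  then have "alt C \<sqsubseteq> \<one>" by (rule alt_le [OF assms one_carrier])
  then show ?thesis using le_carrier(1) by (simp only: ea_poset_sel(1))
qed

text \<open>
  Iterated along a chain on which \<open>f\<close> is isotone, this computes the alternating difference of
  \<open>{f x\<^sub>1} \<Delta> \<dots> \<Delta> {f x\<^sub>n}\<close> from the sequence \<open>f x\<^sub>1 \<le> \<dots> \<le> f x\<^sub>n\<close>, repetitions included. Morphisms and the map \<open>\<alpha>\<close> itself are
  the instances of interest.
\<close>

lemma alt_Sym_Diff_insert:
  assumes X: "finite X" "x \<notin> X" and ch: "f ` X \<in> chains" and m: "f x \<in> ea_carrier E"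
    and ub: "\<And>y. y \<in> X \<Longrightarrow> f y \<sqsubseteq> f x"
  shows "alt (Sym_Diff (\<lambda>x. {f x}) (insert x X)) = f x \<ominus> alt (Sym_Diff (\<lambda>x. {f x}) X)"
proof -
  have sub: "Sym_Diff (\<lambda>x. {f x}) X \<subseteq> f ` X" using X(1) by (rule Sym_Diff_singletons_subset)
  show ?thesis
    unfolding Sym_Diff_insert [OF X]
    by (rule alt_toggle_max [OF finite_chains_subset [OF ch sub] m]) (use sub ub in blast)
qed

text \<open>
  The multiplication law, for chains of any parity. In the inductive step the largest member \<open>M\<close> dominates
  the symmetric difference \<open>S\<close> of the others, so \<open>\<alpha> M \<ominus> \<alpha> S = \<alpha> (M \<Delta> S)\<close>.
\<close>

lemma alt_Sym_Diff_alt: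
  assumes "X \<in> finite_chains (T (ea_poset E))"
  shows "alt (Sym_Diff (\<lambda>C. {alt C}) X) = alt (Sym_Diff (\<lambda>C. C) X)"
proof -
  interpret T: bounded_poset "T (ea_poset E)" by unfold_locales (rule is_bposet_T)
  show ?thesis using assms
  proof (induction rule: T.finite_chain_induct)
    case empty
    then show ?case by simp
  next
    case (insert M X)
    have fin: "finite X" using insert.hyps(1) by (rule finite_chains_finite)
    have le: "(C, M) \<in> kalmbach_le (ea_poset E)" if "C \<in> X" for C
      using insert.hyps(4) that by simp
    have M: "M \<in> even_chains (ea_poset E)" using insert.hyps(2) by simp
    have ev: "C \<in> chains" if "C \<in> insert M X" for C
      using that M finite_chains_carrier [OF insert.hyps(1)] even_chains_finite by fastforce
    have "alt ` X \<in> chains"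
      by (rule finite_chains_image [OF insert.hyps(1)]) (use ev alt_carrier alt_mono in auto)
    then have "alt (Sym_Diff (\<lambda>C. {alt C}) (insert M X)) = alt M \<ominus> alt (Sym_Diff (\<lambda>C. {alt C}) X)"
      by (rule alt_Sym_Diff_insert [OF fin insert.hyps(3)])
        (use ev alt_carrier alt_mono le in blast)+
    also have "\<dots> = alt M \<ominus> alt (Sym_Diff (\<lambda>C. C) X)" by (simp only: insert.IH)
    also have "\<dots> = alt (sym_diff M (Sym_Diff (\<lambda>C. C) X))"
      by (rule diff_eq [OF sums_commute [OF alt_additive [OF
              Sym_Diff_kalmbach_le [OF insert.hyps(1) M le]]]])
    also have "\<dots> = alt (Sym_Diff (\<lambda>C. C) (insert M X))"
      by (simp only: Sym_Diff_insert [OF fin insert.hyps(3)])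
    finally show ?case .
  qed
qed

end


section \<open>The Kalmbach algebra of an effect algebra\<close>

definition kalmbach_algebra :: "'a effect_algebra \<Rightarrow> 'a bposet \<times> ('a set \<Rightarrow> 'a)" where
  "kalmbach_algebra E = (ea_poset E, \<lambda>C \<in> even_chains (ea_poset E). ea_alt E C)"

lemma (in eff_alg) is_T_algebra_kalmbach_algebra: "is_T_algebra (kalmbach_algebra E)"
proof -
  let ?P = "ea_poset E"
  let ?\<alpha> = "\<lambda>C \<in> even_chains ?P. alt C"
  have \<alpha>: "?\<alpha> C = alt C" if "C \<in> even_chains ?P" for C using that by simp
  have empty: "{} \<in> even_chains ?P" by (simp add: even_chains_eq finite_chains_empty)
  have pair: "alt (sym_diff {\<zero>} {a}) = a \<and> sym_diff {\<zero>} {a} \<in> even_chains ?P"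
    if "a \<in> ea_carrier E" for a
  proof -
    have "\<zero> \<sqsubseteq> a" using bot_le [of a] that by simp
    from alt_pair [OF this] pair_even_chain [OF this] diff_zero [OF that] show ?thesis by (simp only:)
  qed
  have car: "alt C \<in> ea_carrier E" if "C \<in> even_chains ?P" for C
    using that even_chains_finite alt_carrier by blast
  have mono: "(?\<alpha> C, ?\<alpha> D) \<in> le ?P" if CD: "(C, D) \<in> kalmbach_le ?P" for C D
  proof -
    have "C \<in> even_chains ?P" "D \<in> even_chains ?P" using CD by (auto simp: kalmbach_le_def)
    with alt_mono [OF CD] show ?thesis by (simp only: \<alpha>)
  qed
  have hom: "?\<alpha> \<in> bpos_hom (T ?P) ?P"
    unfolding bpos_hom_def T_sel ea_poset_sel(1,3,4)
  proof (intro CollectI conjI allI impI mono)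
    show "?\<alpha> \<in> even_chains ?P \<rightarrow>\<^sub>E ea_carrier E" using car by auto
    show "?\<alpha> {} = \<zero>" using empty by (simp add: alt_empty)
    show "?\<alpha> (sym_diff {\<zero>} {\<one>}) = \<one>" using pair [OF one_carrier] \<alpha> by (simp only:)
  qed
  have unit: "bpos_comp ?P ?\<alpha> (\<eta> ?P) = bpos_id ?P"
  proof
    fix a
    show "bpos_comp ?P ?\<alpha> (\<eta> ?P) a = bpos_id ?P a"
    proof (cases "a \<in> ea_carrier E")
      case True
      then have "\<eta> ?P a = sym_diff {\<zero>} {a}" using eta_eq [of a] by (simp only: ea_poset_sel)
      then have "?\<alpha> (\<eta> ?P a) = a" using pair [OF True] \<alpha> by (simp only:)
      then show ?thesis using True by (simp add: bpos_comp_def bpos_id_def compose_def)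
    qed (simp add: bpos_comp_def bpos_id_def compose_def)
  qed
  have mult: "bpos_comp (T (T ?P)) ?\<alpha> (T_map (T ?P) ?\<alpha>) = bpos_comp (T (T ?P)) ?\<alpha> (\<mu> ?P)"
  proof
    fix X
    show "bpos_comp (T (T ?P)) ?\<alpha> (T_map (T ?P) ?\<alpha>) X = bpos_comp (T (T ?P)) ?\<alpha> (\<mu> ?P) X"
    proof (cases "X \<in> even_chains (T ?P)")
      case True
      interpret T: bounded_poset "T ?P" by unfold_locales (rule is_bposet_T)
      have X: "X \<in> finite_chains (T ?P)" using True by (rule even_chains_finite)
      have fin: "finite X" using X by (rule finite_chains_finite)
      have ev: "C \<in> even_chains ?P" if "C \<in> X" for C using finite_chains_carrier [OF X that] by simp
      have eq: "Sym_Diff (\<lambda>C. {?\<alpha> C}) X = Sym_Diff (\<lambda>C. {alt C}) X"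
        using ev by (intro Sym_Diff_cong [OF fin]) simp
      have "alt ` X \<in> chains"
        by (rule finite_chains_image [OF X]) (use ev car alt_mono in auto)
      then have 1: "Sym_Diff (\<lambda>C. {alt C}) X \<in> even_chains ?P"
        using Sym_Diff_image_even_chain [OF True] by blast
      have 2: "Sym_Diff (\<lambda>C. C) X \<in> even_chains ?P"
      proof -
        have "sym_diff {\<zero>} {\<one>} \<in> even_chains ?P" using pair [OF one_carrier] by (simp only:)
        moreover have "(C, sym_diff {\<zero>} {\<one>}) \<in> kalmbach_le ?P" if "C \<in> X" for C
          using T.le_top [of C] ev [OF that] by simp
        ultimately show ?thesis
          using Sym_Diff_kalmbach_le [OF X] by (auto simp: kalmbach_le_def)
      qed
      have "T_map (T ?P) ?\<alpha> X = Sym_Diff (\<lambda>C. {?\<alpha> C}) X"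
        using True by (simp only: T_map_def restrict_apply T_sel if_True)
      then have "?\<alpha> (T_map (T ?P) ?\<alpha> X) = alt (Sym_Diff (\<lambda>C. {alt C}) X)"
        by (simp only: eq \<alpha> [OF 1])
      moreover have "\<mu> ?P X = Sym_Diff (\<lambda>C. C) X"
        using True by (simp only: \<mu>_def restrict_apply T_sel if_True)
      then have "?\<alpha> (\<mu> ?P X) = alt (Sym_Diff (\<lambda>C. C) X)"
        by (simp only: \<alpha> [OF 2])
      ultimately have "?\<alpha> (T_map (T ?P) ?\<alpha> X) = ?\<alpha> (\<mu> ?P X)"
        by (simp only: alt_Sym_Diff_alt [OF X])
      then show ?thesis
        using True by (simp only: bpos_comp_def compose_def T_sel restrict_apply if_True)
    qed (simp add: bpos_comp_def compose_def)
  qed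
  show ?thesis
    unfolding is_T_algebra_def kalmbach_algebra_def
    using is_bposet_ea_poset hom unit mult by (simp only: prod.case)
qed

lemma ea_hom_zero:
  assumes E: "is_effect_algebra E" and F: "is_effect_algebra F" and h: "h \<in> ea_hom E F"
  shows "h (ea_zero E) = ea_zero F"
proof -
  interpret E: eff_alg E by unfold_locales (rule E)
  interpret F: eff_alg F by unfold_locales (rule F)
  have "E.sums (ea_zero E) (ea_one E) (ea_one E)"
    using E.sums_zero [OF E.one_carrier] by (rule E.sums_commute)
  then have "F.sums (h (ea_zero E)) (ea_one F) (ea_one F)"
    using h by (fastforce simp: ea_hom_def)
  then show ?thesis by (rule F.sums_one)
qed

lemma alt_Sym_Diff_hom:
  assumes E: "is_effect_algebra E" and F: "is_effect_algebra F" and h: "h \<in> ea_hom E F"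
    and C: "C \<in> finite_chains (ea_poset E)"
  shows "h ` C \<in> finite_chains (ea_poset F) \<and> ea_alt F (Sym_Diff (\<lambda>x. {h x}) C) = h (ea_alt E C)"
proof -
  interpret E: eff_alg E by unfold_locales (rule E)
  interpret F: eff_alg F by unfold_locales (rule F)
  have carr: "\<And>x. x \<in> ea_carrier E \<Longrightarrow> h x \<in> ea_carrier F"
    and plus: "\<And>a b c. E.sums a b c \<Longrightarrow> F.sums (h a) (h b) (h c)"
    using h by (auto simp: ea_hom_def)
  have mono: "(h x, h y) \<in> le (ea_poset F)" if "(x, y) \<in> le (ea_poset E)" for x y
    using that plus by auto
  have chain: "h ` D \<in> finite_chains (ea_poset F)" if "D \<in> finite_chains (ea_poset E)" for D
    by (rule finite_chains_image [OF that])
      (use carr mono finite_chains_carrier [OF that] in auto)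
  note zero = ea_hom_zero [OF E F h]
  have "ea_alt F (Sym_Diff (\<lambda>x. {h x}) C) = h (ea_alt E C)"
    using C
  proof (induction rule: E.finite_chain_induct)
    case empty
    then show ?case by (simp add: E.alt_empty F.alt_empty zero)
  next
    case (insert m C)
    have fin: "finite C" using insert.hyps(1) by (rule finite_chains_finite)
    have m: "m \<in> ea_carrier E" using insert.hyps(2) by simp
    have "ea_alt F (Sym_Diff (\<lambda>x. {h x}) (insert m C)) = ea_diff F (h m) (h (ea_alt E C))"
      unfolding insert.IH [symmetric]
      by (rule F.alt_Sym_Diff_insert [OF fin insert.hyps(3) chain [OF insert.hyps(1)] carr [OF m]])
        (rule mono [OF insert.hyps(4)])
    also have "\<dots> = h (ea_diff E m (ea_alt E C))"
      by (intro F.diff_eq plus E.sums_diff E.alt_le [OF insert.hyps(1) m insert.hyps(4)])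
    also have "ea_diff E m (ea_alt E C) = ea_alt E (insert m C)"
      using E.alt_insert [OF insert.hyps(1,3,4)] by simp
    finally show ?case .
  qed
  with chain [OF C] show ?thesis by blast
qed

text \<open>
  A morphism of effect algebras preserves differences, hence alternating differences. Conversely, on a
  chain \<open>[a < c]\<close> the structure maps are subtraction, so compatibility with them gives \<open>h (c \<ominus> a) = h c \<ominus> h a\<close>.
\<close>

lemma T_algebra_hom_kalmbach_algebra:
  assumes E: "is_effect_algebra E" and F: "is_effect_algebra F"
  shows "T_algebra_hom (kalmbach_algebra E) (kalmbach_algebra F) = ea_hom E F"
proof
  interpret E: eff_alg E by unfold_locales (rule E)
  interpret F: eff_alg F by unfold_locales (rule F)
  let ?\<alpha> = "\<lambda>C \<in> even_chains (ea_poset E). ea_alt E C"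
  let ?\<beta> = "\<lambda>C \<in> even_chains (ea_poset F). ea_alt F C"
  show "ea_hom E F \<subseteq> T_algebra_hom (kalmbach_algebra E) (kalmbach_algebra F)"
  proof
    fix h assume h: "h \<in> ea_hom E F"
    then have car: "h \<in> ea_carrier E \<rightarrow>\<^sub>E ea_carrier F" and one: "h (ea_one E) = ea_one F"
      and plus: "\<And>a b c. E.sums a b c \<Longrightarrow> F.sums (h a) (h b) (h c)"
      by (auto simp: ea_hom_def)
    from ea_hom_zero [OF E F h] have "h \<in> bpos_hom (ea_poset E) (ea_poset F)"
      using car one unfolding bpos_hom_def ea_poset_sel by (blast intro: plus)
    moreover have "bpos_comp (T (ea_poset E)) h ?\<alpha>
        = bpos_comp (T (ea_poset E)) ?\<beta> (T_map (ea_poset E) h)"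
    proof
      fix C
      show "bpos_comp (T (ea_poset E)) h ?\<alpha> C
        = bpos_comp (T (ea_poset E)) ?\<beta> (T_map (ea_poset E) h) C"
      proof (cases "C \<in> even_chains (ea_poset E)")
        case True
        note H = alt_Sym_Diff_hom [OF E F h even_chains_finite [OF True]]
        have "Sym_Diff (\<lambda>x. {h x}) C \<in> even_chains (ea_poset F)"
          using Sym_Diff_image_even_chain [OF True] H by blast
        then show ?thesis using True H by (simp add: bpos_comp_def compose_def T_map_def)
      qed (simp add: bpos_comp_def compose_def)
    qed
    ultimately show "h \<in> T_algebra_hom (kalmbach_algebra E) (kalmbach_algebra F)"
      by (simp add: T_algebra_hom_def kalmbach_algebra_def)
  qed
  show "T_algebra_hom (kalmbach_algebra E) (kalmbach_algebra F) \<subseteq> ea_hom E F"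
  proof
    fix h assume "h \<in> T_algebra_hom (kalmbach_algebra E) (kalmbach_algebra F)"
    then have h: "h \<in> bpos_hom (ea_poset E) (ea_poset F)"
      and comp: "bpos_comp (T (ea_poset E)) h ?\<alpha> = bpos_comp (T (ea_poset E)) ?\<beta> (T_map (ea_poset E) h)"
      by (auto simp: T_algebra_hom_def kalmbach_algebra_def)
    have mono: "\<And>x y. (x, y) \<in> le (ea_poset E) \<Longrightarrow> (h x, h y) \<in> le (ea_poset F)"
      using h by (simp only: bpos_hom_def) blast
    have "F.sums (h a) (h b) (h c)" if abc: "E.sums a b c" for a b c
    proof -
      have le: "(a, c) \<in> le (ea_poset E)" using abc by auto
      let ?C = "sym_diff {a} {c}"
      have C: "?C \<in> even_chains (ea_poset E)" and hC: "sym_diff {h a} {h c} \<in> even_chains (ea_poset F)"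
        using E.pair_even_chain [OF le] F.pair_even_chain [OF mono [OF le]] .
      have "T_map (ea_poset E) h ?C = sym_diff {h a} {h c}"
        using C by (simp only: T_map_def restrict_apply T_sel if_True Sym_Diff_pair)
      moreover have "h (?\<alpha> ?C) = ?\<beta> (T_map (ea_poset E) h ?C)"
        using fun_cong [OF comp, of ?C] C
        by (simp only: bpos_comp_def compose_def restrict_apply T_sel if_True)
      ultimately have "h (ea_alt E ?C) = ea_alt F (sym_diff {h a} {h c})"
        using C hC by (simp only: restrict_apply if_True)
      then have "h (ea_diff E c a) = ea_diff F (h c) (h a)"
        by (simp only: E.alt_pair [OF le] F.alt_pair [OF mono [OF le]])
      then have "h b = ea_diff F (h c) (h a)" by (simp only: E.diff_eq [OF abc])
      then show ?thesis using F.sums_diff [OF mono [OF le]] by (simp only:)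
    qed
    then show "h \<in> ea_hom E F" using h by (simp add: ea_hom_def bpos_hom_def)
  qed
qed


section \<open>Difference posets\<close>

text \<open>
  The orthosum of \<open>a\<close> and \<open>b\<close> is the element from which subtracting \<open>b\<close> leaves \<open>a\<close>.
\<close>

definition diff_plus :: "'a bposet \<Rightarrow> ('a \<Rightarrow> 'a \<Rightarrow> 'a) \<Rightarrow> 'a \<Rightarrow> 'a \<Rightarrow> 'a option" where
  "diff_plus P d a b =
     (if \<exists>c. (b, c) \<in> le P \<and> d c b = a then Some (SOME c. (b, c) \<in> le P \<and> d c b = a) else None)"

text \<open>
  Difference posets in the sense of Kopka and Chovanec, with a subtraction that is meaningful for
  \<open>b \<le> c\<close> only.
\<close>

locale difference_poset = bounded_poset P
  for P :: "'a bposet" +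
  fixes d :: "'a \<Rightarrow> 'a \<Rightarrow> 'a" (infixl "\<ominus>" 65)
  assumes diff_bot: "c \<in> carrier P \<Longrightarrow> c \<ominus> bot_el P = c"
    and diff_le: "(b, c) \<in> le P \<Longrightarrow> (c \<ominus> b, c) \<in> le P"
    and diff_diff: "(b, c) \<in> le P \<Longrightarrow> c \<ominus> (c \<ominus> b) = b"
    and diff_antimono: "(a, b) \<in> le P \<Longrightarrow> (b, c) \<in> le P \<Longrightarrow> (c \<ominus> b, c \<ominus> a) \<in> le P"
    and diff_diff_diff: "(a, b) \<in> le P \<Longrightarrow> (b, c) \<in> le P \<Longrightarrow> (c \<ominus> a) \<ominus> (c \<ominus> b) = b \<ominus> a"
begin

text \<open>
  The usual formula \<open>a \<oplus> b = (a' \<ominus> b)'\<close> for the orthosum in terms of subtraction, with \<open>a = c \<ominus> b\<close> and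
  \<open>x' = 1 \<ominus> x\<close>. It shows that \<open>c\<close> is determined by \<open>b\<close> and \<open>c \<ominus> b\<close>, so orthosums are single-valued.
\<close>

lemma minuend_from_diff:
  assumes "(b, c) \<in> le P"
  shows "top_el P \<ominus> ((top_el P \<ominus> (c \<ominus> b)) \<ominus> b) = c"
proof -
  let ?u = "top_el P \<ominus> (c \<ominus> b)"
  have c: "(c, top_el P) \<in> le P" using assms le_carrier le_top by blast
  have "?u \<ominus> (top_el P \<ominus> c) = b"
    using diff_diff_diff [OF diff_le [OF assms] c] diff_diff [OF assms] by simp
  then have "?u \<ominus> b = top_el P \<ominus> c"
    using diff_diff [OF diff_antimono [OF diff_le [OF assms] c]] by simp
  then show ?thesis using diff_diff [OF c] by simp
qed

lemma diff_plus_iff: "diff_plus P d a b = Some c \<longleftrightarrow> (b, c) \<in> le P \<and> c \<ominus> b = a"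
proof -
  have unique: "x = c" if "(b, c) \<in> le P" "c \<ominus> b = a" "(b, x) \<in> le P" "x \<ominus> b = a" for x c
    using minuend_from_diff that by metis
  show ?thesis
  proof (cases "\<exists>c. (b, c) \<in> le P \<and> c \<ominus> b = a")
    case True
    then have "(b, SOME c. (b, c) \<in> le P \<and> c \<ominus> b = a) \<in> le P
        \<and> (SOME c. (b, c) \<in> le P \<and> c \<ominus> b = a) \<ominus> b = a"
      by (rule someI_ex)
    with True unique show ?thesis unfolding diff_plus_def by auto
  qed (auto simp: diff_plus_def)
qed

definition diff_ea :: "'a effect_algebra" where
  "diff_ea = \<lparr> ea_carrier = carrier P, ea_plus = diff_plus P d,
     ea_zero = bot_el P, ea_one = top_el P \<rparr>"

lemma is_effect_algebra_diff_ea: "is_effect_algebra diff_ea"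
proof -
  have car: "a \<in> carrier P \<and> b \<in> carrier P \<and> c \<in> carrier P"
    if "diff_plus P d a b = Some c" for a b c
    using that diff_le le_carrier unfolding diff_plus_iff by blast
  have comm: "diff_plus P d b a = Some c" if "diff_plus P d a b = Some c" for a b c
    using that diff_le diff_diff unfolding diff_plus_iff by blast
  have assoc: "\<exists>f. diff_plus P d b c = Some f \<and> diff_plus P d a f = Some e"
    if abd: "diff_plus P d a b = Some x" and xce: "diff_plus P d x c = Some e" for a b c x e
  proof -
    have a: "(a, x) \<in> le P" "x \<ominus> a = b" using comm [OF abd] by (auto simp: diff_plus_iff)
    have x: "(x, e) \<in> le P" "e \<ominus> x = c" using comm [OF xce] by (auto simp: diff_plus_iff)
    \<comment> \<open>With \<open>x = a \<oplus> b\<close> and \<open>e = x \<oplus> c\<close>, the witness for \<open>b \<oplus> c\<close> is \<open>e \<ominus> a\<close>.\<close>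
    have ae: "(a, e) \<in> le P" using a x le_trans by blast
    have "diff_plus P d b c = Some (e \<ominus> a)"
      unfolding diff_plus_iff
      using diff_antimono [OF a(1) x(1)] diff_diff_diff [OF a(1) x(1)] a x by simp
    moreover have "diff_plus P d a (e \<ominus> a) = Some e"
      unfolding diff_plus_iff using diff_le [OF ae] diff_diff [OF ae] by blast
    ultimately show ?thesis by blast
  qed
  have compl: "\<exists>!a'. a' \<in> carrier P \<and> diff_plus P d a a' = Some (top_el P)" if a: "a \<in> carrier P" for a
  proof (rule ex1I [of _ "top_el P \<ominus> a"])
    have "diff_plus P d (top_el P \<ominus> a) a = Some (top_el P)"
      using le_top [OF a] by (simp add: diff_plus_iff)
    then show "top_el P \<ominus> a \<in> carrier P \<and> diff_plus P d a (top_el P \<ominus> a) = Some (top_el P)"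
      using comm car by blast
    show "a' = top_el P \<ominus> a" if "a' \<in> carrier P \<and> diff_plus P d a a' = Some (top_el P)" for a'
      using that comm [of a a' "top_el P"] by (simp add: diff_plus_iff)
  qed
  have one: "a = bot_el P" if "diff_plus P d a (top_el P) = Some c" for a c
  proof -
    have c: "(top_el P, c) \<in> le P" "c \<ominus> top_el P = a" using that by (auto simp: diff_plus_iff)
    then have "c = top_el P" using le_top le_carrier le_antisym by blast
    moreover have "top_el P \<ominus> top_el P = bot_el P"
      using diff_diff [OF bot_le [OF top_carrier]] diff_bot [OF top_carrier] by simp
    ultimately show ?thesis using c by simp
  qed
  show ?thesis
    unfolding is_effect_algebra_def diff_ea_def effect_algebra.select_convs
  proof (intro conjI allI ballI impI)
    show "bot_el P \<in> carrier P" by (rule bot_carrier)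
    show "top_el P \<in> carrier P" by (rule top_carrier)
  qed (use car comm assoc compl one in blast)+
qed

end


section \<open>The effect algebra of a Kalmbach algebra\<close>

text \<open>
  The symmetric difference makes \<open>c \<ominus> c\<close> the value of \<open>\<alpha>\<close> at the empty chain, which is the bottom element.
\<close>

definition algebra_diff :: "('a set \<Rightarrow> 'a) \<Rightarrow> 'a \<Rightarrow> 'a \<Rightarrow> 'a" where
  "algebra_diff \<alpha> c b = \<alpha> (sym_diff {b} {c})"

definition algebra_ea :: "'a bposet \<times> ('a set \<Rightarrow> 'a) \<Rightarrow> 'a effect_algebra" where
  "algebra_ea = (\<lambda>(A, \<alpha>). \<lparr> ea_carrier = carrier A, ea_plus = diff_plus A (algebra_diff \<alpha>),
     ea_zero = bot_el A, ea_one = top_el A \<rparr>)"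

locale T_algebra =
  fixes A :: "'a bposet" and \<alpha> :: "'a set \<Rightarrow> 'a"
  assumes T_algebra: "is_T_algebra (A, \<alpha>)"
begin

sublocale bounded_poset A
  using T_algebra by unfold_locales (simp add: is_T_algebra_def)

lemma alpha_mono: "(C, D) \<in> kalmbach_le A \<Longrightarrow> (\<alpha> C, \<alpha> D) \<in> le A"
  and alpha_empty: "\<alpha> {} = bot_el A"
  and alpha_extensional: "\<alpha> \<in> extensional (even_chains A)"
  and alpha_unit: "a \<in> carrier A \<Longrightarrow> \<alpha> (sym_diff {bot_el A} {a}) = a"
proof -
  have hom: "\<alpha> \<in> bpos_hom (T A) A" and unit: "bpos_comp A \<alpha> (\<eta> A) = bpos_id A"
    using T_algebra by (simp_all add: is_T_algebra_def)
  show "(C, D) \<in> kalmbach_le A \<Longrightarrow> (\<alpha> C, \<alpha> D) \<in> le A" and "\<alpha> {} = bot_el A"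
    and "\<alpha> \<in> extensional (even_chains A)"
    using hom by (auto simp: bpos_hom_def PiE_def)
  show "\<alpha> (sym_diff {bot_el A} {a}) = a" if a: "a \<in> carrier A"
    using fun_cong [OF unit, of a] a eta_eq [OF a]
    by (simp only: bpos_comp_def compose_def bpos_id_def restrict_apply if_True)
qed

text \<open>
  The associativity law of the algebra at \<open>[D < C]\<close>: the left-hand side applies \<open>\<alpha>\<close> to \<open>{\<alpha> D} \<Delta> {\<alpha> C}\<close>, the
  right-hand side to \<open>D \<Delta> C\<close>. For \<open>C = D\<close> both chains are empty.
\<close>

lemma algebra_diff_alpha:
  assumes le: "(D, C) \<in> kalmbach_le A"
  shows "algebra_diff \<alpha> (\<alpha> C) (\<alpha> D) = \<alpha> (sym_diff D C)"
proof -
  interpret T: bounded_poset "T A" by unfold_locales (rule is_bposet_T)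
  let ?X = "sym_diff {D} {C}"
  have X: "?X \<in> even_chains (T A)" using le by (intro T.pair_even_chain) simp
  have "bpos_comp (T (T A)) \<alpha> (T_map (T A) \<alpha>) = bpos_comp (T (T A)) \<alpha> (\<mu> A)"
    using T_algebra by (simp add: is_T_algebra_def)
  from fun_cong [OF this, of ?X] X have "\<alpha> (T_map (T A) \<alpha> ?X) = \<alpha> (\<mu> A ?X)"
    by (simp only: bpos_comp_def compose_def T_sel restrict_apply if_True)
  moreover have "T_map (T A) \<alpha> ?X = sym_diff {\<alpha> D} {\<alpha> C}"
    using X by (simp only: T_map_def restrict_apply T_sel if_True Sym_Diff_pair)
  moreover have "\<mu> A ?X = sym_diff D C"
    using X by (simp only: \<mu>_def restrict_apply T_sel if_True Sym_Diff_pair)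
  ultimately show ?thesis by (simp only: algebra_diff_def)
qed

text \<open>
  Subtracting the bottom element is the unit law; every other axiom is \<open>algebra_diff_alpha\<close> or
  monotonicity of \<open>\<alpha>\<close> at a comparison of two-element chains ending in \<open>c\<close>:
  \<open>[b < c] \<le> [0 < c]\<close> for the axioms about two elements, \<open>[b < c] \<le> [a < c]\<close> for those about three.
\<close>

sublocale difference_poset A "algebra_diff \<alpha>"
proof
  have pair_le_eta: "(sym_diff {b} {c}, sym_diff {bot_el A} {c}) \<in> kalmbach_le A"
    if "(b, c) \<in> le A" for b c
    using bot_le [OF le_carrier(1) [OF that]] that by (rule pair_le_pair)
  show "algebra_diff \<alpha> c (bot_el A) = c" if "c \<in> carrier A" for c
    unfolding algebra_diff_def using that by (rule alpha_unit)
  show "(algebra_diff \<alpha> c b, c) \<in> le A" if bc: "(b, c) \<in> le A" for b c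
    using alpha_mono [OF pair_le_eta [OF bc]] alpha_unit [OF le_carrier(2) [OF bc]]
    by (simp only: algebra_diff_def)
  show "algebra_diff \<alpha> c (algebra_diff \<alpha> c b) = b" if bc: "(b, c) \<in> le A" for b c
  proof -
    have "sym_diff (sym_diff {b} {c}) (sym_diff {bot_el A} {c}) = sym_diff {bot_el A} {b}" by auto
    then show ?thesis
      using algebra_diff_alpha [OF pair_le_eta [OF bc]]
        alpha_unit [OF le_carrier(1) [OF bc]] alpha_unit [OF le_carrier(2) [OF bc]]
      by (simp only: algebra_diff_def [of \<alpha> c b])
  qed
  show "(algebra_diff \<alpha> c b, algebra_diff \<alpha> c a) \<in> le A"
    if "(a, b) \<in> le A" "(b, c) \<in> le A" for a b c
    unfolding algebra_diff_def by (rule alpha_mono [OF pair_le_pair [OF that]])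
  show "algebra_diff \<alpha> (algebra_diff \<alpha> c a) (algebra_diff \<alpha> c b) = algebra_diff \<alpha> b a"
    if "(a, b) \<in> le A" "(b, c) \<in> le A" for a b c
  proof -
    have "sym_diff (sym_diff {b} {c}) (sym_diff {a} {c}) = sym_diff {a} {b}" by auto
    then show ?thesis
      using algebra_diff_alpha [OF pair_le_pair [OF that]] by (simp only: algebra_diff_def [of \<alpha> _ a]
        algebra_diff_def [of \<alpha> c b])
  qed
qed

lemma algebra_ea_eq: "algebra_ea (A, \<alpha>) = diff_ea"
  by (simp add: algebra_ea_def diff_ea_def)

lemma is_effect_algebra_algebra_ea: "is_effect_algebra (algebra_ea (A, \<alpha>))"
  unfolding algebra_ea_eq by (rule is_effect_algebra_diff_ea)

lemma ea_poset_algebra_ea: "ea_poset (algebra_ea (A, \<alpha>)) = A"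
proof -
  have "(a, b) \<in> le A \<longleftrightarrow> (\<exists>c. diff_plus A (algebra_diff \<alpha>) a c = Some b)" for a b
    unfolding diff_plus_iff using diff_le diff_diff by metis
  then have "{(a, b). \<exists>c. diff_plus A (algebra_diff \<alpha>) a c = Some b} = le A" by auto
  then show ?thesis by (simp add: ea_poset_def algebra_ea_eq diff_ea_def)
qed

lemma ea_diff_algebra_ea:
  assumes "(b, c) \<in> le A"
  shows "ea_diff (algebra_ea (A, \<alpha>)) c b = algebra_diff \<alpha> c b"
proof -
  interpret E: eff_alg "algebra_ea (A, \<alpha>)" by unfold_locales (rule is_effect_algebra_algebra_ea)
  show ?thesis
    using diff_le [OF assms] diff_diff [OF assms]
    by (intro E.diff_eq) (simp add: algebra_ea_eq diff_ea_def diff_plus_iff)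
qed

text \<open>
  \<open>\<alpha>\<close> is defined on even chains only. Toggling the bottom element makes an odd chain even without affecting
  its alternating difference, because \<open>x \<ominus> 0 = x\<close> and \<open>0 \<ominus> 0 = 0\<close>.
\<close>

definition even_part :: "'a set \<Rightarrow> 'a set" where
  "even_part C = (if even (card C) then C else sym_diff {bot_el A} C)"

lemma even_part_insert:
  assumes "finite C" "m \<notin> C"
  shows "even_part (insert m C) = sym_diff (even_part C) (sym_diff {bot_el A} {m})"
proof (cases "even (card C)")
  case True
  then have "even_part (insert m C) = sym_diff {bot_el A} (insert m C)" "even_part C = C"
    using assms by (simp_all add: even_part_def)
  then show ?thesis using assms(2) by (simp only:) blast
next
  case False
  then have "even_part (insert m C) = insert m C" "even_part C = sym_diff {bot_el A} C"
    using assms by (simp_all add: even_part_def)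
  then show ?thesis using assms(2) by (simp only:) blast
qed

lemma even_part_le:
  assumes C: "C \<in> finite_chains A" and m: "m \<in> carrier A" and ub: "\<And>c. c \<in> C \<Longrightarrow> (c, m) \<in> le A"
  shows "(even_part C, sym_diff {bot_el A} {m}) \<in> kalmbach_le A"
proof (rule even_chain_le_pair [OF _ m])
  have sub: "even_part C \<subseteq> insert (bot_el A) C" by (auto simp: even_part_def)
  have "insert (bot_el A) C \<in> finite_chains A"
    using C bot_le bot_carrier le_refl by (auto simp: finite_chains_def Chains_def)
  then have "even_part C \<in> finite_chains A" using sub by (rule finite_chains_subset)
  moreover have "even (card (even_part C))"
  proof (cases "even (card C)")
    case False
    have "even (card (sym_diff {bot_el A} C)) \<longleftrightarrow> (even (card {bot_el A}) \<longleftrightarrow> even (card C))"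
      using finite_chains_finite [OF C] by (intro even_card_sym_diff) auto
    with False show ?thesis by (simp add: even_part_def)
  qed (simp add: even_part_def)
  ultimately show "even_part C \<in> even_chains A" by (simp add: even_chains_eq)
  show "(b, m) \<in> le A" if "b \<in> even_part C" for b
    using that sub ub bot_le [OF m] by blast
qed

text \<open>
  Adjoining a maximum \<open>m\<close> replaces the even part \<open>B\<close> by \<open>B \<Delta> [0 < m]\<close>. As \<open>B \<le> [0 < m]\<close> and
  \<open>\<alpha> [0 < m] = m\<close>, the value of \<open>\<alpha>\<close> changes from \<open>\<alpha> B\<close> to \<open>m \<ominus> \<alpha> B\<close>, as in the alternating difference.
\<close>

lemma ea_alt_algebra_ea:
  assumes "C \<in> finite_chains A"
  shows "ea_alt (algebra_ea (A, \<alpha>)) C = \<alpha> (even_part C)"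
proof -
  interpret E: eff_alg "algebra_ea (A, \<alpha>)" by unfold_locales (rule is_effect_algebra_algebra_ea)
  note poset = ea_poset_algebra_ea
  show ?thesis using assms
  proof (induction rule: finite_chain_induct)
    case empty
    have "ea_zero (algebra_ea (A, \<alpha>)) = bot_el A" by (simp add: algebra_ea_def)
    then show ?case by (simp add: E.alt_empty even_part_def alpha_empty)
  next
    case (insert m C)
    have le: "(even_part C, sym_diff {bot_el A} {m}) \<in> kalmbach_le A"
      by (rule even_part_le [OF insert.hyps(1,2,4)])
    have "ea_alt (algebra_ea (A, \<alpha>)) (insert m C)
        = ea_diff (algebra_ea (A, \<alpha>)) m (\<alpha> (even_part C))"
      unfolding insert.IH [symmetric]
      by (rule E.alt_insert) (simp_all only: poset insert.hyps(1,3,4) not_False_eq_True)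
    also have "\<dots> = algebra_diff \<alpha> m (\<alpha> (even_part C))"
      using alpha_mono [OF le] alpha_unit [OF insert.hyps(2)]
      by (intro ea_diff_algebra_ea) (simp only:)
    also have "\<dots> = \<alpha> (sym_diff (even_part C) (sym_diff {bot_el A} {m}))"
      using algebra_diff_alpha [OF le] alpha_unit [OF insert.hyps(2)] by (simp only:)
    also have "\<dots> = \<alpha> (even_part (insert m C))"
      by (simp only: even_part_insert [OF finite_chains_finite [OF insert.hyps(1)] insert.hyps(3)])
    finally show ?case .
  qed
qed

lemma kalmbach_algebra_algebra_ea: "kalmbach_algebra (algebra_ea (A, \<alpha>)) = (A, \<alpha>)"
proof -
  have "(\<lambda>C \<in> even_chains A. ea_alt (algebra_ea (A, \<alpha>)) C) = \<alpha>"
  proof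
    fix C
    show "(\<lambda>C \<in> even_chains A. ea_alt (algebra_ea (A, \<alpha>)) C) C = \<alpha> C"
    proof (cases "C \<in> even_chains A")
      case True
      then have "C \<in> finite_chains A" "even_part C = C" by (simp_all add: even_chains_eq even_part_def)
      then show ?thesis using True ea_alt_algebra_ea by simp
    next
      case False
      then show ?thesis using alpha_extensional by (simp add: extensional_def)
    qed
  qed
  then show ?thesis by (simp only: kalmbach_algebra_def ea_poset_algebra_ea)
qed

end

lemma algebra_ea_kalmbach_algebra:
  assumes "is_effect_algebra E"
  shows "algebra_ea (kalmbach_algebra E) = E"
proof -
  interpret eff_alg E by unfold_locales (rule assms)
  let ?\<alpha> = "\<lambda>C \<in> even_chains (ea_poset E). alt C"
  interpret T_algebra "ea_poset E" ?\<alpha>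
    by unfold_locales (use is_T_algebra_kalmbach_algebra in \<open>simp only: kalmbach_algebra_def\<close>)
  have diff: "algebra_diff ?\<alpha> c b = ea_diff E c b" if "b \<sqsubseteq> c" for b c
    using pair_even_chain [OF that] alt_pair [OF that]
    by (simp only: algebra_diff_def restrict_apply if_True)
  have "diff_plus (ea_poset E) (algebra_diff ?\<alpha>) a b = ea_plus E a b" for a b
  proof -
    have "diff_plus (ea_poset E) (algebra_diff ?\<alpha>) a b = Some c \<longleftrightarrow> sums a b c" for c
    proof -
      have "diff_plus (ea_poset E) (algebra_diff ?\<alpha>) a b = Some c \<longleftrightarrow> b \<sqsubseteq> c \<and> ea_diff E c b = a"
        unfolding diff_plus_iff using diff by metis
      also have "\<dots> \<longleftrightarrow> sums b a c" using diff_eq sums_diff by fastforce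
      also have "\<dots> \<longleftrightarrow> sums a b c" using sums_commute by blast
      finally show ?thesis .
    qed
    then show ?thesis by (metis not_None_eq)
  qed
  then have "diff_plus (ea_poset E) (algebra_diff ?\<alpha>) = ea_plus E" by blast
  then show ?thesis by (simp add: algebra_ea_def kalmbach_algebra_def)
qed


section \<open>The isomorphism of categories\<close>

lemma is_category_EA: "is_category (EA :: ('a effect_algebra, 'a \<Rightarrow> 'a) category)"
proof -
  have id: "(\<lambda>x \<in> ea_carrier E. x) \<in> ea_hom E E" if "is_effect_algebra E" for E :: "'a effect_algebra"
  proof -
    interpret eff_alg E by unfold_locales (rule that)
    show ?thesis using one_carrier sums_carrier by (auto simp: ea_hom_def)
  qed
  have comp: "compose (ea_carrier E) g f \<in> ea_hom E G"
    if "is_effect_algebra E" "f \<in> ea_hom E F" "g \<in> ea_hom F G"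
    for E F G :: "'a effect_algebra" and f g
  proof -
    interpret eff_alg E by unfold_locales (rule that)
    show ?thesis using that(2,3) one_carrier sums_carrier
      by (auto simp: ea_hom_def compose_def)
  qed
  have maps: "f \<in> ea_carrier E \<rightarrow> ea_carrier F" "f \<in> extensional (ea_carrier E)"
    if "f \<in> ea_hom E F" for E F :: "'a effect_algebra" and f
    using that by (auto simp: ea_hom_def PiE_def)
  show ?thesis
    unfolding is_category_def EA_def category.select_convs
    by (intro conjI ballI; unfold mem_Collect_eq)
      (assumption | rule id comp compose_Id Id_compose compose_assoc maps)+
qed

text \<open>
  A bijection on objects under which hom-sets, identities and composition agree literally. The category
  axioms for \<open>D\<close> are transported along it, which spares a direct verification for the category of
  \<open>T\<close>-algebras.
\<close>

lemma isomorphic_categories_via_objects: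
  assumes C: "is_category C"
    and F: "\<And>X. X \<in> Obj C \<Longrightarrow> F X \<in> Obj D" and G: "\<And>Y. Y \<in> Obj D \<Longrightarrow> G Y \<in> Obj C"
    and GF: "\<And>X. X \<in> Obj C \<Longrightarrow> G (F X) = X" and FG: "\<And>Y. Y \<in> Obj D \<Longrightarrow> F (G Y) = Y"
    and Hom: "\<And>X Y. X \<in> Obj C \<Longrightarrow> Y \<in> Obj C \<Longrightarrow> Hom D (F X) (F Y) = Hom C X Y"
    and Id: "\<And>X. X \<in> Obj C \<Longrightarrow> Id D (F X) = Id C X"
    and Comp: "\<And>X Y Z f g. X \<in> Obj C \<Longrightarrow> Y \<in> Obj C \<Longrightarrow> Z \<in> Obj C \<Longrightarrow>
      Comp D (F X) (F Y) (F Z) g f = Comp C X Y Z g f"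
  shows "isomorphic_categories C D"
proof -
  have Hom': "Hom D X Y = Hom C (G X) (G Y)" if "X \<in> Obj D" "Y \<in> Obj D" for X Y
    using Hom [of "G X" "G Y"] that by (simp add: FG G)
  have Id': "Id D X = Id C (G X)" if "X \<in> Obj D" for X
    using Id [of "G X"] that by (simp add: FG G)
  have Comp': "Comp D X Y Z g f = Comp C (G X) (G Y) (G Z) g f"
    if "X \<in> Obj D" "Y \<in> Obj D" "Z \<in> Obj D" for X Y Z f g
    using Comp [of "G X" "G Y" "G Z"] that by (simp add: FG G)
  have D: "is_category D"
    using C by (simp add: is_category_def Hom' Id' Comp' G)
  have "is_functor C D F (\<lambda>X Y f. f)"
    by (simp add: is_functor_def F Hom Id Comp)
  moreover have "is_functor D C G (\<lambda>X Y f. f)"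
    by (simp add: is_functor_def G Hom' Id' Comp')
  ultimately show ?thesis
    unfolding isomorphic_categories_def using C D GF FG
    by (intro conjI exI [of _ F] exI [of _ G] exI [of _ "\<lambda>X Y f. f"]) auto
qed

theorem theorem4:
  shows "isomorphic_categories
    (EA :: ('a effect_algebra, 'a \<Rightarrow> 'a) category)
    (BPos_T :: ('a bposet \<times> ('a set \<Rightarrow> 'a), 'a \<Rightarrow> 'a) category)"
proof (rule isomorphic_categories_via_objects [OF is_category_EA, of kalmbach_algebra _ algebra_ea])
  fix E :: "'a effect_algebra" assume "E \<in> Obj EA"
  then have E: "is_effect_algebra E" by (simp add: EA_def)
  then show "kalmbach_algebra E \<in> Obj BPos_T"
    by (simp add: BPos_T_def eff_alg.is_T_algebra_kalmbach_algebra eff_alg_def)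
  show "algebra_ea (kalmbach_algebra E) = E" using E by (rule algebra_ea_kalmbach_algebra)
  show "Id BPos_T (kalmbach_algebra E) = Id EA E"
    by (simp add: BPos_T_def EA_def bpos_id_def kalmbach_algebra_def)
next
  fix X :: "'a bposet \<times> ('a set \<Rightarrow> 'a)" assume "X \<in> Obj BPos_T"
  then obtain A \<alpha> where X: "X = (A, \<alpha>)" and "is_T_algebra (A, \<alpha>)"
    by (cases X) (simp add: BPos_T_def)
  then interpret T_algebra A \<alpha> by unfold_locales
  show "algebra_ea X \<in> Obj EA"
    using is_effect_algebra_algebra_ea by (simp add: X EA_def)
  show "kalmbach_algebra (algebra_ea X) = X"
    unfolding X by (rule kalmbach_algebra_algebra_ea)
next
  fix E F :: "'a effect_algebra" assume "E \<in> Obj EA" "F \<in> Obj EA"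
  then show "Hom BPos_T (kalmbach_algebra E) (kalmbach_algebra F) = Hom EA E F"
    by (simp add: BPos_T_def EA_def T_algebra_hom_kalmbach_algebra)
next
  fix E F G :: "'a effect_algebra" and f g :: "'a \<Rightarrow> 'a"
  show "Comp BPos_T (kalmbach_algebra E) (kalmbach_algebra F) (kalmbach_algebra G) g f
      = Comp EA E F G g f"
    by (simp add: BPos_T_def EA_def bpos_comp_def kalmbach_algebra_def)
qed

end
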